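(* Suppose $n$ is an even integer with $t_1+t_3\leq n<t_2$, and put $K=k_1+k_2+k_3$, $N=\tfrac{n+1}{2}$. Then: (i) the $\mathfrak{BI}$-module $\mathscr M_n(x_1)\cap\mathscr M_n(x_3)$ is isomorphic to $W_1\oplus W_1$, where $W_1=O_{n-t_1-t_3}(k_1+k_2+N,\,-k_2-k_3-N,\,-N)^{((-1,1),(2\,3))}$; (ii) the $\mathfrak{BI}$-modules $\mathscr M_n(x_1)/(\mathscr M_n(x_1)\cap\mathscr M_n(x_3))$ and $\mathscr M_n/\mathscr M_n(x_3)$ are each isomorphic to $W_2\oplus W_2$, where $W_2=O_{t_3-1}(k_2,\,-K-n-1,\,-k_1)^{((1,-1),(2\,3))}$; (iii) the $\mathfrak{BI}$-modules $\mathscr M_n(x_3)/(\mathscr M_n(x_1)\cap\mathscr M_n(x_3))$ and $\mathscr M_n/\mathscr M_n(x_1)$ are each isomorphic to $W_3\oplus W_3$, where $W_3=O_{t_1-1}(k_2,\,-K-n-1,\,-k_3)^{((1,-1),(1\,2\,3))}$. Moreover, if $k_2\geq0$, then $W_1,W_2,W_3$ are irreducible and are isomorphic to $O_{n-t_1-t_3}(-k_1-k_2-N,\,N,\,-k_2-k_3-N)$, $O_{t_3-1}(k_2,\,k_1,\,K+n+1)$ and $O_{t_1-1}(K+n+1,\,k_3,\,k_2)$, respectively.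
   Context: Fix real numbers $k_1,k_2,k_3$. For $i=1,2,3$ let $R_i$ be the operator on functions on $\mathbb R^3$ replacing $x_i$ by $-x_i$, and $T_if=\frac{\partial f}{\partial x_i}+k_i\frac{f-R_if}{x_i}$ (Dunkl operators). Let $\sigma_1=\begin{pmatrix}0&1\\1&0\end{pmatrix}$, $\sigma_2=\begin{pmatrix}0&-\sqrt{-1}\\ \sqrt{-1}&0\end{pmatrix}$, $\sigma_3=\begin{pmatrix}1&0\\0&-1\end{pmatrix}$, and let $e_i$ act on $\mathbb C^2$ by $\sigma_i$. Tensor products are over $\mathbb R$; $\mathbb R[\cdots]_m$ denotes homogeneous polynomials of degree $m$. Let $\mathbf D=e_1\otimes T_1+e_2\otimes T_2+e_3\otimes T_3$ and $\mathscr M_n=\ker(\mathbf D|_{\mathbb C^2\otimes\mathbb R[x_1,x_2,x_3]_n})$. For $i=1,2,3$ set $t_i=-2k_i$ if $2k_i$ is an odd negative integer, and $t_i=\infty$ otherwise. For $i=1,2,3$, $\mathscr M_n(x_i)=\mathscr M_n\cap\bigoplus_{j=t_i}^n\mathbb C^2\otimes(x_i^j\cdot\mathbb R[x_p,x_q]_{n-j})$ where $\{p,q\}=\{1,2,3\}\setminus\{i\}$ (it is $\{0\}$ if $n<t_i$); it is a $\mathfrak{BI}$-submodule of $\mathscr M_n$. $\mathfrak{BI}$ is the unital associative $\mathbb C$-algebra generated by $X,Y,Z$ with relations saying that $\{X,Y\}-Z$, $\{Y,Z\}-X$, $\{Z,X\}-Y$ commute with $X,Y,Z$ ($\{A,B\}=AB+BA$).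 $\mathscr M_n$ is a $\mathfrak{BI}$-module via $X=(\sqrt{-1}\,e_1\otimes(x_3T_2-x_2T_3)+\tfrac12)R_2R_3+k_2R_3+k_3R_2$, $Y=(\sqrt{-1}\,e_2\otimes(x_1T_3-x_3T_1)+\tfrac12)R_1R_3+k_3R_1+k_1R_3$, $Z=(\sqrt{-1}\,e_3\otimes(x_2T_1-x_1T_2)+\tfrac12)R_1R_2+k_1R_2+k_2R_1$, operators composed right to left, $R_i$ acting on the polynomial factor. Twisting: for a $\mathfrak{BI}$-module $V$ and algebra automorphism $\varepsilon$, $V^\varepsilon$ is $V$ with action $x\cdot v=\varepsilon(x)v$. A permutation $\sigma\in\mathfrak S_3$ denotes the automorphism sending the generator with index $i$ in $(X,Y,Z)$ to the generator with index $\sigma(i)$; the sign automorphisms are $(1,-1)\colon X\mapsto X,Y\mapsto -Y,Z\mapsto -Z$; $(-1,1)\colon X\mapsto -X,Y\mapsto Y,Z\mapsto -Z$; $(-1,-1)\colon X\mapsto -X,Y\mapsto -Y,Z\mapsto Z$; a pair $(\epsilon,\sigma)$ denotes the composite $\epsilon\circ\sigma$. For $a,b,c\in\mathbb C$ and even $d\geq0$, $O_d(a,b,c)$ is the $\mathfrak{BI}$-module $\mathbb C^{d+1}$ in which, w.r.t. a basis $v_0,\dots,v_d$, $X$ acts by the lower bidiagonal matrix with diagonal $(\theta_0,\dots,\theta_d)$ and subdiagonal entries $1$, $Y$ by the upper bidiagonal matrix with diagonal $(\theta^*_0,\dots,\theta^*_d)$ and superdiagonal $(\varphi_1,\dots,\varphi_d)$,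 and $Z=\{X,Y\}-(2ab-c(d+1))$, where $\theta_i=\frac{(-1)^i(2a-d+2i)}{2}$, $\theta^*_i=\frac{(-1)^i(2b-d+2i)}{2}$, $\varphi_i=\frac{i(d+1-2i-2a-2b-2c)}{2}$ ($i$ even), $\varphi_i=\frac{(i-d-1)(d+1-2i-2a-2b+2c)}{2}$ ($i$ odd). *)

theory Defs
  imports Complex_Main "HOL-Library.Extended_Nat"
begin

text \<open>An element of C^2 (x)_R R[x1,x2,x3] is encoded by its coefficient function:
  F (j,(a,b,c)) is the coefficient of e-basis vector j (j = 0,1 of C^2) times the
  monomial x1^a x2^b x3^c. Since C^2 (x)_R R[x] = C[x]^2, coefficients are complex.\<close>

type_synonym mono = "nat \<times> nat \<times> nat"
type_synonym pvec = "nat \<times> mono \<Rightarrow> complex"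

fun deg :: "mono \<Rightarrow> nat" where
  "deg (a,b,c) = a + b + c"

fun expo :: "nat \<Rightarrow> mono \<Rightarrow> nat" where
  "expo i (a,b,c) = (if i = 1 then a else if i = 2 then b else c)"

fun incr :: "nat \<Rightarrow> mono \<Rightarrow> mono" where
  "incr i (a,b,c) = (if i = 1 then (a+1,b,c) else if i = 2 then (a,b+1,c) else (a,b,c+1))"

fun decr :: "nat \<Rightarrow> mono \<Rightarrow> mono" where
  "decr i (a,b,c) = (if i = 1 then (a-1,b,c) else if i = 2 then (a,b-1,c) else (a,b,c-1))"

definition PolySpace :: "nat \<Rightarrow> pvec set" where
  "PolySpace n = {F. \<forall>j \<alpha>. F (j,\<alpha>) \<noteq> 0 \<longrightarrow> j < 2 \<and> deg \<alpha> = n}"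

definition refl :: "nat \<Rightarrow> pvec \<Rightarrow> pvec" where
  "refl i F = (\<lambda>(j,\<alpha>). (-1) ^ expo i \<alpha> * F (j,\<alpha>))"

definition partial :: "nat \<Rightarrow> pvec \<Rightarrow> pvec" where
  "partial i F = (\<lambda>(j,\<alpha>). of_nat (expo i \<alpha> + 1) * F (j, incr i \<alpha>))"

text \<open>Division by x_i (exact on polynomials divisible by x_i, such as f - R_i f).\<close>
definition divx :: "nat \<Rightarrow> pvec \<Rightarrow> pvec" where
  "divx i F = (\<lambda>(j,\<alpha>). F (j, incr i \<alpha>))"

definition mulx :: "nat \<Rightarrow> pvec \<Rightarrow> pvec" where
  "mulx i F = (\<lambda>(j,\<alpha>). if expo i \<alpha> = 0 then 0 else F (j, decr i \<alpha>))"

definition dunkl :: "(nat \<Rightarrow> real) \<Rightarrow> nat \<Rightarrow> pvec \<Rightarrow> pvec" where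
  "dunkl k i F = (\<lambda>m. partial i F m + of_real (k i) * divx i (\<lambda>m'. F m' - refl i F m') m)"

definition sig :: "nat \<Rightarrow> pvec \<Rightarrow> pvec" where
  "sig i F = (\<lambda>(j,\<alpha>).
     if i = 1 then (if j = 0 then F (1,\<alpha>) else if j = 1 then F (0,\<alpha>) else 0)
     else if i = 2 then (if j = 0 then - \<i> * F (1,\<alpha>) else if j = 1 then \<i> * F (0,\<alpha>) else 0)
     else (if j = 0 then F (0,\<alpha>) else if j = 1 then - F (1,\<alpha>) else 0))"

definition Dirac :: "(nat \<Rightarrow> real) \<Rightarrow> pvec \<Rightarrow> pvec" where
  "Dirac k F = (\<lambda>m. sig 1 (dunkl k 1 F) m + sig 2 (dunkl k 2 F) m + sig 3 (dunkl k 3 F) m)"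

definition Mn :: "(nat \<Rightarrow> real) \<Rightarrow> nat \<Rightarrow> pvec set" where
  "Mn k n = {F \<in> PolySpace n. Dirac k F = (\<lambda>_. 0)}"

definition tpar :: "real \<Rightarrow> enat" where
  "tpar \<kappa> = (if \<exists>m::int. odd m \<and> m < 0 \<and> 2 * \<kappa> = real_of_int m
               then enat (nat \<lfloor>- 2 * \<kappa>\<rfloor>) else \<infinity>)"

definition Mnx :: "(nat \<Rightarrow> real) \<Rightarrow> nat \<Rightarrow> nat \<Rightarrow> pvec set" where
  "Mnx k n i = {F \<in> Mn k n. \<forall>j \<alpha>. F (j,\<alpha>) \<noteq> 0 \<longrightarrow> tpar (k i) \<le> enat (expo i \<alpha>)}"

definition biop :: "(nat \<Rightarrow> real) \<Rightarrow> nat \<Rightarrow> nat \<Rightarrow> nat \<Rightarrow> pvec \<Rightarrow> pvec" where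
  "biop k i p q F =
     (let G = refl p (refl q F);
          A = (\<lambda>m. mulx q (dunkl k p G) m - mulx p (dunkl k q G) m)
      in (\<lambda>m. \<i> * sig i A m + 1/2 * G m + of_real (k p) * refl q F m + of_real (k q) * refl p F m))"

text \<open>Action of the generators X (index 1), Y (index 2), Z (index 3) on M_n.\<close>
definition actM :: "(nat \<Rightarrow> real) \<Rightarrow> nat \<Rightarrow> pvec \<Rightarrow> pvec" where
  "actM k g = (if g = 1 then biop k 1 2 3 else if g = 2 then biop k 2 3 1 else biop k 3 1 2)"

definition Ocar :: "nat \<Rightarrow> (nat \<Rightarrow> complex) set" where
  "Ocar d = {v. \<forall>i > d. v i = 0}"

definition Otheta :: "nat \<Rightarrow> complex \<Rightarrow> nat \<Rightarrow> complex" where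
  "Otheta d a i = (-1) ^ i * (2 * a - of_nat d + 2 * of_nat i) / 2"

definition Ophi :: "nat \<Rightarrow> complex \<Rightarrow> complex \<Rightarrow> complex \<Rightarrow> nat \<Rightarrow> complex" where
  "Ophi d a b c i = (if even i
      then of_nat i * (of_nat d + 1 - 2 * of_nat i - 2 * a - 2 * b - 2 * c) / 2
      else (of_nat i - of_nat d - 1) * (of_nat d + 1 - 2 * of_nat i - 2 * a - 2 * b + 2 * c) / 2)"

definition OX :: "nat \<Rightarrow> complex \<Rightarrow> (nat \<Rightarrow> complex) \<Rightarrow> (nat \<Rightarrow> complex)" where
  "OX d a v = (\<lambda>i. if i \<le> d then Otheta d a i * v i + (if 0 < i then v (i - 1) else 0) else 0)"

definition OY :: "nat \<Rightarrow> complex \<Rightarrow> complex \<Rightarrow> complex \<Rightarrow> (nat \<Rightarrow> complex) \<Rightarrow> (nat \<Rightarrow> complex)" where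
  "OY d a b c v = (\<lambda>i. if i \<le> d then Otheta d b i * v i
                        + (if i < d then Ophi d a b c (i + 1) * v (i + 1) else 0) else 0)"

definition OZ :: "nat \<Rightarrow> complex \<Rightarrow> complex \<Rightarrow> complex \<Rightarrow> (nat \<Rightarrow> complex) \<Rightarrow> (nat \<Rightarrow> complex)" where
  "OZ d a b c v = (\<lambda>i. OX d a (OY d a b c v) i + OY d a b c (OX d a v) i
                        - (2 * a * b - c * (of_nat d + 1)) * v i)"

definition Oact :: "nat \<Rightarrow> complex \<Rightarrow> complex \<Rightarrow> complex \<Rightarrow> nat \<Rightarrow> (nat \<Rightarrow> complex) \<Rightarrow> (nat \<Rightarrow> complex)" where
  "Oact d a b c g = (if g = 1 then OX d a else if g = 2 then OY d a b c else OZ d a b c)"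

definition sgnaut :: "complex \<times> complex \<Rightarrow> nat \<Rightarrow> complex" where
  "sgnaut s g = (if g = 1 then fst s else if g = 2 then snd s else fst s * snd s)"

text \<open>Twist by (eps, sigma) = eps o sigma: generator i acts as eps(generator sigma(i)).\<close>
definition twist :: "complex \<times> complex \<Rightarrow> (nat \<Rightarrow> nat) \<Rightarrow> (nat \<Rightarrow> ('i \<Rightarrow> complex) \<Rightarrow> ('i \<Rightarrow> complex))
                      \<Rightarrow> nat \<Rightarrow> ('i \<Rightarrow> complex) \<Rightarrow> ('i \<Rightarrow> complex)" where
  "twist s \<sigma> act g v = (\<lambda>x. sgnaut s (\<sigma> g) * act (\<sigma> g) v x)"

definition perm23 :: "nat \<Rightarrow> nat" where
  "perm23 i = (if i = 2 then 3 else if i = 3 then 2 else i)"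

definition perm123 :: "nat \<Rightarrow> nat" where
  "perm123 i = (if i = 1 then 2 else if i = 2 then 3 else if i = 3 then 1 else i)"

definition dsum_car :: "('i \<Rightarrow> complex) set \<Rightarrow> (bool \<times> 'i \<Rightarrow> complex) set" where
  "dsum_car V = {h. (\<lambda>i. h (False,i)) \<in> V \<and> (\<lambda>i. h (True,i)) \<in> V}"

definition dsum_act :: "(nat \<Rightarrow> ('i \<Rightarrow> complex) \<Rightarrow> ('i \<Rightarrow> complex)) \<Rightarrow> nat
                        \<Rightarrow> (bool \<times> 'i \<Rightarrow> complex) \<Rightarrow> (bool \<times> 'i \<Rightarrow> complex)" where
  "dsum_act act g h = (\<lambda>(s,i). act g (\<lambda>i'. h (s,i')) i)"

definition clinear_on :: "('i \<Rightarrow> complex) set \<Rightarrow> (('i \<Rightarrow> complex) \<Rightarrow> ('j \<Rightarrow> complex)) \<Rightarrow> bool" where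
  "clinear_on V f \<longleftrightarrow> (\<forall>u\<in>V. \<forall>w\<in>V. \<forall>c::complex.
       f (\<lambda>x. c * u x + w x) = (\<lambda>y. c * f u y + f w y))"

definition bi_iso :: "('i \<Rightarrow> complex) set \<Rightarrow> (nat \<Rightarrow> ('i \<Rightarrow> complex) \<Rightarrow> ('i \<Rightarrow> complex))
     \<Rightarrow> ('j \<Rightarrow> complex) set \<Rightarrow> (nat \<Rightarrow> ('j \<Rightarrow> complex) \<Rightarrow> ('j \<Rightarrow> complex)) \<Rightarrow> bool" where
  "bi_iso V actV W actW \<longleftrightarrow> (\<exists>f. clinear_on V f \<and> bij_betw f V W \<and>
      (\<forall>g\<in>{1,2,3}. \<forall>v\<in>V. f (actV g v) = actW g (f v)))"

definition bi_quot_iso :: "('i \<Rightarrow> complex) set \<Rightarrow> ('i \<Rightarrow> complex) set \<Rightarrow> (nat \<Rightarrow> ('i \<Rightarrow> complex) \<Rightarrow> ('i \<Rightarrow> complex))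
     \<Rightarrow> ('j \<Rightarrow> complex) set \<Rightarrow> (nat \<Rightarrow> ('j \<Rightarrow> complex) \<Rightarrow> ('j \<Rightarrow> complex)) \<Rightarrow> bool" where
  "bi_quot_iso V N actV W actW \<longleftrightarrow> (\<exists>f. clinear_on V f \<and> f ` V = W \<and>
      (\<forall>v\<in>V. f v = (\<lambda>_. 0) \<longleftrightarrow> v \<in> N) \<and>
      (\<forall>g\<in>{1,2,3}. \<forall>v\<in>V. f (actV g v) = actW g (f v)))"

definition csubspace_of :: "('i \<Rightarrow> complex) set \<Rightarrow> bool" where
  "csubspace_of U \<longleftrightarrow> (\<lambda>_. 0) \<in> U \<and> (\<forall>u\<in>U. \<forall>w\<in>U. \<forall>c::complex. (\<lambda>x. c * u x + w x) \<in> U)"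

definition bi_irreducible :: "('i \<Rightarrow> complex) set \<Rightarrow> (nat \<Rightarrow> ('i \<Rightarrow> complex) \<Rightarrow> ('i \<Rightarrow> complex)) \<Rightarrow> bool" where
  "bi_irreducible V act \<longleftrightarrow> V \<noteq> {\<lambda>_. 0} \<and>
     (\<forall>U \<subseteq> V. csubspace_of U \<and> (\<forall>g\<in>{1,2,3}. \<forall>u\<in>U. act g u \<in> U)
        \<longrightarrow> U = {\<lambda>_. 0} \<or> U = V)"

end

theory Submission
  imports Defs
begin

text \<open>Restricting F in M_n to the plane x_2 = 0 and using the Dirac equation to eliminate the
  x_2-derivative turns X and Z into bidiagonal operators of opposite directions on the coefficients
  of x_1^a x_3^(n-a), and Y into a tridiagonal one. As n < t_2, the Cauchy-Kovalevskaya recursion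
  in x_2 extends every restriction uniquely. The off-diagonal entries vanish at a = t_1 and
  n - a = t_3, so the a-axis splits into three blocks; after rescaling, each of them is one of the
  twisted modules O_d. The multiplicity two comes from the operator e_3 R_3, which commutes with
  X, Y, Z and whose two eigenspaces are exchanged by e_1 R_1.

  In a module on which {X,Y} - Z and {X,Z} - Y act by the same scalars as on O_d(a,b,c), a vector v_0
  generates a homomorphic image of O_d(a,b,c) as soon as Y acts as prescribed on v_0 and on
  (X - theta_0) v_0, and the product of all X - theta_i kills v_0. This gives the sign twist (v_0 the first basis vector)
  and the twist exchanging Y and Z (v_0 an explicit eigenvector of Z); together with
  reversal of the basis these produce all required isomorphisms. Irreducibility follows because
  they also provide a cyclic eigenvector of Y for the last eigenvalue, which lies in every nonzero
  submodule.\<close>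

section \<open>The modules O_d(a,b,c)\<close>

text \<open>Rescaling a basis changes the off-diagonal entries of X and Y but not the product of two
  opposite ones. In O_d(a,b,c) the entries of X are normalised to 1 and phi_i is this product, so
  recognising a block of the restricted action as some O_d amounts to comparing three diagonals and
  one list of products. Exchanging generators changes the parameters. For every parameter triple
  that occurs, nonvanishing of the phi_i means that two of the four numbers a+b+c, a-b-c, b-a-c,
  c-a-b avoid finitely many values. For W_1, W_2, W_3 the constant k_2 enters precisely a-b-c and
  b-a-c, and k_2 >= 0 pushes these two out of the critical range. Evenness of n gives the x_1- and
  x_3-exponents on the plane the same parity. It also makes d even in all three blocks, which is why
  phi_{d+1} = 0.\<close>

lemma Ophi_0 [simp]: "Ophi d a b c 0 = 0"
  and Ophi_top [simp]: "even d \<Longrightarrow> Ophi d a b c (Suc d) = 0"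
  by (auto simp: Ophi_def)

text \<open>The diagonal of Z, which is tridiagonal in the basis v_0, ..., v_d.\<close>

definition Ozeta :: "nat \<Rightarrow> complex \<Rightarrow> nat \<Rightarrow> complex" where
  "Ozeta d c i = (if even i then c + of_nat d / 2 else - c - of_nat d / 2 - 1)"

text \<open>Neighbouring eigenvalues add up to 1 or -1, so the off-diagonal entries of {X,Y} are
  those of X and Y up to alternating signs.\<close>

lemma Otheta_Suc: "Otheta d a (Suc i) = - Otheta d a i - (-1) ^ i"
  by (simp add: Otheta_def field_simps)

lemma Ozeta_Suc: "Ozeta d c (Suc i) = - 1 - Ozeta d c i"
  by (simp add: Ozeta_def)

text \<open>The diagonal entry of {X,Y} minus its scalar; the two phi-terms come from stepping to a
  neighbour with one generator and back with the other.\<close>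

lemma Ozeta_diag:
  "2 * Otheta d a i * Otheta d b i + Ophi d a b c i + Ophi d a b c (Suc i)
     - (2 * a * b - c * (of_nat d + 1)) = Ozeta d c i"
  by (cases "even i") (simp_all add: Otheta_def Ophi_def Ozeta_def field_simps)

text \<open>The diagonal entry of the relation between {X,Z} and Y, with the off-diagonal signs of Z
  inserted.\<close>

lemma Otheta_diag:
  "2 * Ozeta d c i * Otheta d a i + (-1) ^ i * (Ophi d a b c i - Ophi d a b c (Suc i))
     = Otheta d b i + (2 * a * c - b * (of_nat d + 1))"
  by (cases "even i") (simp_all add: Otheta_def Ophi_def Ozeta_def field_simps)

lemma OX_car: "OX d a v \<in> Ocar d" and OY_car: "OY d a b c v \<in> Ocar d"
  by (auto simp: Ocar_def OX_def OY_def)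

lemma OZ_car: "v \<in> Ocar d \<Longrightarrow> OZ d a b c v \<in> Ocar d"
  by (auto simp: Ocar_def OX_def OY_def OZ_def)

lemma OX_0: "OX d a v 0 = Otheta d a 0 * v 0"
  and OX_Suc: "Suc i \<le> d \<Longrightarrow> OX d a v (Suc i) = Otheta d a (Suc i) * v (Suc i) + v i"
  by (auto simp: OX_def)

lemma OY_row: "v \<in> Ocar d \<Longrightarrow> OY d a b c v i = Otheta d b i * v i + Ophi d a b c (Suc i) * v (Suc i)"
  by (auto simp: OY_def Ocar_def)

text \<open>The truncation of X above index d is invisible behind the factor phi_{d+1} = 0.\<close>

lemma Ophi_OX_Suc:
  assumes "even d" "v \<in> Ocar d" "i \<le> d"
  shows "Ophi d a b c (Suc i) * OX d e v (Suc i)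
    = Ophi d a b c (Suc i) * (Otheta d e (Suc i) * v (Suc i) + v i)"
  using assms by (cases "i = d") (auto simp: OX_def)

lemma OZ_0:
  assumes "even d" "v \<in> Ocar d"
  shows "OZ d a b c v 0 = Ozeta d c 0 * v 0 - Ophi d a b c 1 * v 1"
  unfolding OZ_def OX_0 OY_row[OF assms(2)] OY_row[OF OX_car] One_nat_def Ophi_OX_Suc[OF assms le0]
    Ozeta_diag[of d a 0 b c, symmetric]
  by (simp add: algebra_simps Otheta_Suc)

lemma OZ_Suc:
  assumes "even d" "v \<in> Ocar d" "Suc i \<le> d"
  shows "OZ d a b c v (Suc i) = Ozeta d c (Suc i) * v (Suc i) - (-1) ^ i * v i
    + (-1) ^ i * Ophi d a b c (Suc (Suc i)) * v (Suc (Suc i))"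
  unfolding OZ_def OX_Suc[OF assms(3)] OY_row[OF assms(2)] OY_row[OF OX_car] Ophi_OX_Suc[OF assms]
    Ozeta_diag[of d a "Suc i" b c, symmetric]
  by (simp add: algebra_simps Otheta_Suc)

text \<open>Entrywise comparison. Two below the diagonal the alternating signs of Z cancel; one
  below, the sum -1 of neighbouring \<open>Ozeta\<close> cancels against that of neighbouring
  \<open>Otheta\<close>; the diagonal is \<open>Otheta_diag\<close>; one above, phi
  reappears.\<close>

lemma OX_OZ:
  assumes "even d" "v \<in> Ocar d"
  shows "OX d a (OZ d a b c v) i + OZ d a b c (OX d a v) i
     = OY d a b c v i + (2 * a * c - b * (of_nat d + 1)) * v i"
proof (cases "i \<le> d")
  case False
  then show ?thesis
    using OX_car[of d a] OZ_car[OF OX_car, of d a b c a v] OY_car[of d a b c v] assms(2)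
    by (auto simp: Ocar_def)
next
  case True
  show ?thesis
  proof (cases i)
    case 0
    have D: "Otheta d b 0 = 2 * Ozeta d c 0 * Otheta d a 0 - Ophi d a b c (Suc 0)
      - (2 * a * c - b * (of_nat d + 1))"
      using Otheta_diag[of d c 0 a b, symmetric] by (simp add: algebra_simps)
    show ?thesis
      unfolding 0 OX_0 OZ_0[OF assms] OZ_0[OF assms(1) OX_car] OY_row[OF assms(2)] One_nat_def
        Ophi_OX_Suc[OF assms le0] D
      by (simp add: algebra_simps Otheta_Suc)
  next
    case (Suc j)
    have j: "Suc j \<le> d" "j \<le> d" using True Suc by auto
    have *: "Ophi d a b c (Suc (Suc j)) * OX d a v (Suc (Suc j))
      = Ophi d a b c (Suc (Suc j)) * (Otheta d a (Suc (Suc j)) * v (Suc (Suc j)) + v (Suc j))"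
      by (rule Ophi_OX_Suc[OF assms j(1)])
    have D: "Otheta d b (Suc j) = 2 * Ozeta d c (Suc j) * Otheta d a (Suc j)
      - (-1) ^ j * (Ophi d a b c (Suc j) - Ophi d a b c (Suc (Suc j))) - (2 * a * c - b * (of_nat d + 1))"
      using Otheta_diag[of d c "Suc j" a b, symmetric] by (simp add: algebra_simps)
    have Z: "OZ d a b c (OX d a v) (Suc j) = Ozeta d c (Suc j) * (Otheta d a (Suc j) * v (Suc j) + v j)
      - (-1) ^ j * OX d a v j
      + (-1) ^ j * (Ophi d a b c (Suc (Suc j)) * (Otheta d a (Suc (Suc j)) * v (Suc (Suc j)) + v (Suc j)))"
      unfolding OZ_Suc[OF assms(1) OX_car j(1)] OX_Suc[OF j(1)] *[symmetric] by (simp add: algebra_simps)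
    show ?thesis
    \<comment> \<open>Row j of Z also occurs, and row 0 has no lower neighbour.\<close>
    proof (cases j)
      case 0
      show ?thesis
        unfolding Suc Z OX_Suc[OF j(1)] OZ_Suc[OF assms j(1)] OY_row[OF assms(2)] D 
        unfolding 0 OX_0 OZ_0[OF assms]
        by (simp add: algebra_simps Otheta_Suc Ozeta_Suc)
    next
      case (Suc l)
      have s: "((-1) ^ l * (-1) ^ l :: complex) = 1" by (simp flip: power_add)
      have s': "(-1) ^ l * ((-1) ^ l * x) = (x::complex)" for x by (simp add: s flip: mult.assoc)
      show ?thesis
        unfolding \<open>i = Suc j\<close> Z OX_Suc[OF j(1)] OZ_Suc[OF assms j(1)] OY_row[OF assms(2)] D
        using j
        unfolding Suc
        by (simp add: OX_Suc OZ_Suc[OF assms]) (simp add: algebra_simps Otheta_Suc Ozeta_Suc s s')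
    qed
  qed
qed

section \<open>Homomorphisms out of O_d(a,b,c)\<close>

lemma clinear_UNIV_D:
  assumes "clinear_on UNIV X"
  shows clinear_UNIV_add: "X (\<lambda>x. u x + w x) = (\<lambda>y. X u y + X w y)"
    and clinear_UNIV_scale: "X (\<lambda>x. c * u x) = (\<lambda>y. c * X u y)"
    and clinear_UNIV_zero: "X (\<lambda>x. 0) = (\<lambda>y. 0)"
    and clinear_UNIV_diff: "X (\<lambda>x. u x - w x) = (\<lambda>y. X u y - X w y)"
proof -
  have l: "X (\<lambda>x. c * u x + w x) = (\<lambda>y. c * X u y + X w y)" for c u w
    using assms unfolding clinear_on_def by blast
  show add: "X (\<lambda>x. u x + w x) = (\<lambda>y. X u y + X w y)" for u w
    using l[of 1 u w] by simp
  show zero: "X (\<lambda>x. 0) = (\<lambda>y. 0)"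
    using l[of "-1" "\<lambda>x. 0" "\<lambda>x. 0"] by simp
  show scale: "X (\<lambda>x. c * u x) = (\<lambda>y. c * X u y)" for c u
    using l[of c u "\<lambda>x. 0"] zero by simp
  show "X (\<lambda>x. u x - w x) = (\<lambda>y. X u y - X w y)"
    using l[of "-1" w u] by simp
qed

lemma clinear_UNIV_sum:
  assumes "clinear_on UNIV X" "finite J"
  shows "X (\<lambda>x. \<Sum>j\<in>J. v j * q j x) = (\<lambda>y. \<Sum>j\<in>J. v j * X (q j) y)"
  using assms(2)
  by induction (simp_all add: clinear_UNIV_D[OF assms(1)])

lemma OX_linear: "clinear_on UNIV (OX d a)"
  by (auto simp: clinear_on_def OX_def fun_eq_iff algebra_simps)

lemma OY_linear: "clinear_on UNIV (OY d a b c)"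
  by (auto simp: clinear_on_def OY_def fun_eq_iff algebra_simps)

lemma OZ_linear: "clinear_on UNIV (OZ d a b c)"
  by (auto simp: clinear_on_def OZ_def fun_eq_iff clinear_UNIV_D[OF OX_linear]
      clinear_UNIV_D[OF OY_linear] algebra_simps)

text \<open>Solving the relation for {X,Y} for Z and inserting the result into the relation for
  {X,Z} gives the cubic relation \<open>R\<close>. On q_i it expresses Y q_{i+2} through Y q_i and Y
  q_{i+1}, so two initial values determine Y on the chain. The prescribed coefficients obey the same
  recursion by \<open>Ozeta_diag\<close> and \<open>Otheta_diag\<close>.\<close>

lemma bidiagonal_chain:
  assumes X: "clinear_on UNIV X" and Y: "clinear_on UNIV Y"
    and q: "\<And>i. q (Suc i) = (\<lambda>x. X (q i) x - Otheta d a i * q i x)"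
    and R: "\<And>i x. X (X (Y (q i))) x + 2 * X (Y (X (q i))) x + Y (X (X (q i))) x
      = Y (q i) x + (2 * a * c - b * (of_nat d + 1)) * q i x
        + 2 * (2 * a * b - c * (of_nat d + 1)) * X (q i) x"
    and Y0: "Y (q 0) = (\<lambda>x. Otheta d b 0 * q 0 x)"
    and Y1: "Y (q 1) = (\<lambda>x. Otheta d b 1 * q 1 x + Ophi d a b c 1 * q 0 x)"
  shows "Y (q i) = (\<lambda>x. Otheta d b i * q i x + Ophi d a b c i * q (i - 1) x)"
proof -
  note lin = clinear_UNIV_D[OF X] clinear_UNIV_D[OF Y]
  have Xq: "X (q i) = (\<lambda>x. Otheta d a i * q i x + q (Suc i) x)" for i
    by (auto simp: q fun_eq_iff)
  have "Y (q i) = (\<lambda>x. Otheta d b i * q i x + Ophi d a b c i * q (i - 1) x) \<and>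
    Y (q (Suc i)) = (\<lambda>x. Otheta d b (Suc i) * q (Suc i) x + Ophi d a b c (Suc i) * q i x)" for i
  proof (induction i)
    case 0
    then show ?case using Y0 Y1 by simp
  next
    case (Suc i)
    have Yi: "Y (q i) = (\<lambda>x. Otheta d b i * q i x + Ophi d a b c i * q (i - 1) x)"
      and Yi1: "Y (q (Suc i)) = (\<lambda>x. Otheta d b (Suc i) * q (Suc i) x + Ophi d a b c (Suc i) * q i x)"
      using Suc by auto
    have "Y (q (Suc (Suc i))) x
      = Otheta d b (Suc (Suc i)) * q (Suc (Suc i)) x + Ophi d a b c (Suc (Suc i)) * q (Suc i) x" for x
    proof -
      have "Y (q (Suc (Suc i))) x = Y (q i) x + (2 * a * c - b * (of_nat d + 1)) * q i x
        + 2 * (2 * a * b - c * (of_nat d + 1)) * X (q i) x - X (X (Y (q i))) x - 2 * X (Y (X (q i))) x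
        - Otheta d a i * Otheta d a i * Y (q i) x - (Otheta d a i + Otheta d a (Suc i)) * Y (q (Suc i)) x"
        using R[of i x] unfolding Xq lin by (simp add: algebra_simps)
      note E = this
      define s :: complex where "s = (-1) ^ i"
      define t u f g where "t = Otheta d a i" and "u = Otheta d b i"
        and "f = Ophi d a b c i" and "g = Ophi d a b c (Suc i)"
      have s2: "s * s = 1" "s * (s * z) = z" for z
        by (simp_all add: s_def flip: power_add mult.assoc)
      have th: "Otheta d a (Suc i) = - t - s" "Otheta d b (Suc i) = - u - s"
        "Otheta d b (Suc (Suc i)) = u + 2 * s"
        by (simp_all add: Otheta_Suc t_def u_def s_def)
      \<comment> \<open>The values of \<open>Ozeta\<close> at i and i+1 add up to -1; written out by
        \<open>Ozeta_diag\<close>, this is a recursion for phi.\<close>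
      have ph: "Ophi d a b c (Suc (Suc i))
        = 2 * (2 * a * b - c * (of_nat d + 1)) - 1 - 2 * t * u - 2 * (t + s) * (u + s) - f - 2 * g"
        using Ozeta_diag[of d a "Suc i" b c] unfolding Ozeta_Suc th Ozeta_diag[of d a i b c, symmetric]
        by (simp add: t_def u_def f_def g_def algebra_simps)
      have lam: "2 * a * c - b * (of_nat d + 1)
        = 2 * t * (2 * t * u + f + g - (2 * a * b - c * (of_nat d + 1))) + s * (f - g) - u"
        using Otheta_diag[of d c i a b] unfolding Ozeta_diag[of d a i b c, symmetric]
        by (simp add: t_def u_def f_def g_def s_def algebra_simps)
      \<comment> \<open>At i = 0 the index i - 1 is again 0; the formula for X h is then protected
        by the factor f = phi_0 = 0.\<close>
      define h where "h = q (i - 1)"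
      have Xh: "f * X h y = f * ((s - t) * h y + q i y)"
        and Xh': "X (\<lambda>y. f * h y) = (\<lambda>y. f * ((s - t) * h y + q i y))" for y
      proof -
        show "f * X h y = f * ((s - t) * h y + q i y)" for y
          by (cases i) (simp_all add: f_def h_def Xq t_def s_def Otheta_Suc)
        then show "X (\<lambda>y. f * h y) = (\<lambda>y. f * ((s - t) * h y + q i y))"
          unfolding clinear_UNIV_scale[OF X] by (rule ext)
      qed
      have Y': "Y (q i) = (\<lambda>x. u * q i x + f * h x)" "Y (q (Suc i)) = (\<lambda>x. (- u - s) * q (Suc i) x + g * q i x)"
        unfolding Yi Yi1 th by (simp_all add: u_def f_def g_def h_def)
      have X': "X (q i) = (\<lambda>x. t * q i x + q (Suc i) x)"
        "X (q (Suc i)) = (\<lambda>x. (- t - s) * q (Suc i) x + q (Suc (Suc i)) x)"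
        unfolding Xq th by (simp_all add: t_def)
      have XYi: "X (Y (q i)) = (\<lambda>x. u * (t * q i x + q (Suc i) x) + (s - t) * (f * h x) + f * q i x)"
        unfolding Y' clinear_UNIV_add[OF X] Xh' clinear_UNIV_scale[OF X] X' by (simp add: algebra_simps)
      have XXYi: "X (X (Y (q i))) = (\<lambda>x. u * (t * (t * q i x + q (Suc i) x) + ((- t - s) * q (Suc i) x + q (Suc (Suc i)) x))
        + (s - t) * (f * ((s - t) * h x + q i x)) + f * (t * q i x + q (Suc i) x))"
        unfolding XYi clinear_UNIV_add[OF X] clinear_UNIV_scale[OF X] X' Xh ..
      have XYXi: "X (Y (X (q i))) = (\<lambda>x. t * X (Y (q i)) x + (- u - s) * X (q (Suc i)) x + g * X (q i) x)"
        unfolding X'(1) clinear_UNIV_add[OF Y] clinear_UNIV_scale[OF Y] clinear_UNIV_add[OF X]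
          clinear_UNIV_scale[OF X] Y'(2) by (simp add: X' algebra_simps)
      show ?thesis
        unfolding E XXYi XYXi th ph lam unfolding XYi X' unfolding Y'
        by (simp add: algebra_simps s2 flip: t_def u_def g_def)
    qed
    then show ?case using Suc by auto
  qed
  then show ?thesis by blast
qed

lemma bidiagonal_hom:
  assumes X: "clinear_on UNIV X" and Y: "clinear_on UNIV Y" and "even d"
    and Xq: "\<And>i. i < d \<Longrightarrow> X (q i) = (\<lambda>x. Otheta d a i * q i x + q (Suc i) x)"
    and Xd: "X (q d) = (\<lambda>x. Otheta d a d * q d x)"
    and Yq: "\<And>i. i \<le> d \<Longrightarrow> Y (q i) = (\<lambda>x. Otheta d b i * q i x + Ophi d a b c i * q (i - 1) x)"
    and v: "v \<in> Ocar d"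
  defines "F \<equiv> \<lambda>v x. \<Sum>j\<le>d. v j * q j x"
  shows "F (OX d a v) = X (F v)" "F (OY d a b c v) = Y (F v)"
proof -
  show "F (OX d a v) = X (F v)"
  proof
    fix x
    have "F (OX d a v) x = (\<Sum>j\<le>d. Otheta d a j * v j * q j x) + (\<Sum>j\<le>d. if 0 < j then v (j - 1) * q j x else 0)"
      unfolding F_def sum.distrib[symmetric]
      by (intro sum.cong) (auto simp: OX_def algebra_simps)
    also have "(\<Sum>j\<le>d. if 0 < j then v (j - 1) * q j x else 0) = (\<Sum>j<d. v j * q (Suc j) x)"
      unfolding lessThan_Suc_atMost[symmetric] by (subst sum.lessThan_Suc_shift) auto
    also have "\<dots> = (\<Sum>j\<le>d. if j < d then v j * q (Suc j) x else 0)"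
      by (auto simp flip: lessThan_Suc_atMost)
    also have "(\<Sum>j\<le>d. Otheta d a j * v j * q j x) + \<dots> = (\<Sum>j\<le>d. v j * X (q j) x)"
      unfolding sum.distrib[symmetric]
    proof (intro sum.cong refl)
      fix j assume "j \<in> {..d}"
      then show "Otheta d a j * v j * q j x + (if j < d then v j * q (Suc j) x else 0) = v j * X (q j) x"
        by (cases "j = d") (auto simp: Xq Xd algebra_simps)
    qed
    finally show "F (OX d a v) x = X (F v) x"
      by (simp add: F_def clinear_UNIV_sum[OF X])
  qed
  show "F (OY d a b c v) = Y (F v)"
  proof
    fix x
    have "F (OY d a b c v) x = (\<Sum>j\<le>d. Otheta d b j * v j * q j x) + (\<Sum>j<Suc d. Ophi d a b c (Suc j) * v (Suc j) * q j x)"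
      unfolding F_def sum.distrib[symmetric] lessThan_Suc_atMost
      by (intro sum.cong) (auto simp: OY_row[OF v] algebra_simps)
    also have "(\<Sum>j<Suc d. Ophi d a b c (Suc j) * v (Suc j) * q j x) = (\<Sum>j<d. Ophi d a b c (Suc j) * v (Suc j) * q j x)"
      using \<open>even d\<close> by simp
    also have "\<dots> = (\<Sum>j\<le>d. Ophi d a b c j * v j * q (j - 1) x)"
      unfolding lessThan_Suc_atMost[symmetric] by (subst sum.lessThan_Suc_shift) auto
    also have "(\<Sum>j\<le>d. Otheta d b j * v j * q j x) + \<dots> = (\<Sum>j\<le>d. v j * Y (q j) x)"
      unfolding sum.distrib[symmetric]
      by (intro sum.cong) (auto simp: Yq algebra_simps)
    finally show "F (OY d a b c v) x = Y (F v) x"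
      by (simp add: F_def clinear_UNIV_sum[OF Y])
  qed
qed

definition basis_vec :: "nat \<Rightarrow> nat \<Rightarrow> complex" where
  "basis_vec i = (\<lambda>j. if j = i then 1 else 0)"

lemma basis_vec_car: "i \<le> d \<Longrightarrow> basis_vec i \<in> Ocar d"
  by (simp add: Ocar_def basis_vec_def)

lemma Ocar_expand:
  assumes "v \<in> Ocar d"
  shows "v = (\<lambda>x. \<Sum>j\<le>d. v j * basis_vec j x)"
proof
  fix x
  have "(\<Sum>j\<le>d. v j * basis_vec j x) = (\<Sum>j\<le>d. if j = x then v j else 0)"
    by (intro sum.cong) (auto simp: basis_vec_def)
  then show "v x = (\<Sum>j\<le>d. v j * basis_vec j x)"
    using assms by (auto simp: Ocar_def)
qed

lemma Ocar_lin:
  "u \<in> Ocar d \<Longrightarrow> w \<in> Ocar d \<Longrightarrow> (\<lambda>x. u x + w x) \<in> Ocar d"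
  "u \<in> Ocar d \<Longrightarrow> w \<in> Ocar d \<Longrightarrow> (\<lambda>x. u x - w x) \<in> Ocar d"
  "u \<in> Ocar d \<Longrightarrow> (\<lambda>x. e * u x) \<in> Ocar d"
  "u \<in> Ocar d \<Longrightarrow> (\<lambda>x. - u x) \<in> Ocar d"
  by (simp_all add: Ocar_def)

lemma clinear_UNIV_uminus:
  "clinear_on UNIV X \<Longrightarrow> X (\<lambda>x. - u x) = (\<lambda>y. - X u y)"
  using clinear_UNIV_scale[of X "-1" u] by simp

lemma basis_vec_Suc:
  "i < d \<Longrightarrow> basis_vec (Suc i) = (\<lambda>x. OX d a (basis_vec i) x - Otheta d a i * basis_vec i x)"
  by (auto simp: fun_eq_iff basis_vec_def OX_def)

text \<open>\<open>basis_vec 0\<close> generates \<open>Ocar d\<close> under X. This is how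
  composites of two homomorphisms are recognised as identities.\<close>

lemma OX_cyclic:
  assumes X: "\<And>v. v \<in> Ocar d \<Longrightarrow> f (OX d a v) = OX d a (f v)"
    and f: "clinear_on UNIV f" and f0: "f (basis_vec 0) = basis_vec 0" and v: "v \<in> Ocar d"
  shows "f v = v"
proof -
  have "i \<le> d \<Longrightarrow> f (basis_vec i) = basis_vec i" for i
  proof (induction i)
    case (Suc i)
    then show ?case
      using X[OF basis_vec_car[of i d]]
      by (simp add: basis_vec_Suc[of i d a] clinear_UNIV_D[OF f])
  qed (simp add: f0)
  then have "f (\<lambda>x. \<Sum>j\<le>d. v j * basis_vec j x) = (\<lambda>x. \<Sum>j\<le>d. v j * basis_vec j x)"
    by (simp add: clinear_UNIV_sum[OF f])
  then show ?thesis by (simp flip: Ocar_expand[OF v])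
qed

text \<open>X and Y are arbitrary operators on \<open>Ocar d\<close>, because the lemma is applied
  with -X in place of X and with -Z in place of Y.\<close>

lemma O_universal:
  assumes X: "clinear_on UNIV X" and Y: "clinear_on UNIV Y" and "even d"
    and Xc: "\<forall>v\<in>Ocar d. X v \<in> Ocar d"
    and R: "\<forall>v\<in>Ocar d. \<forall>x. X (X (Y v)) x + 2 * X (Y (X v)) x + Y (X (X v)) x
      = Y v x + (2 * a * c - b * (of_nat d + 1)) * v x
        + 2 * (2 * a * b - c * (of_nat d + 1)) * X v x"
    and q: "\<And>i. q (Suc i) = (\<lambda>x. X (q i) x - Otheta d a i * q i x)"
    and q0: "q 0 \<in> Ocar d" and q_end: "q (Suc d) = (\<lambda>x. 0)"
    and Y0: "Y (q 0) = (\<lambda>x. Otheta d b 0 * q 0 x)"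
    and Y1: "Y (q 1) = (\<lambda>x. Otheta d b 1 * q 1 x + Ophi d a b c 1 * q 0 x)"
  defines "F \<equiv> \<lambda>v x. \<Sum>j\<le>d. v j * q j x"
  shows "clinear_on UNIV F" "F (basis_vec 0) = q 0" "F v \<in> Ocar d"
    "v \<in> Ocar d \<Longrightarrow> F (OX d a v) = X (F v)" "v \<in> Ocar d \<Longrightarrow> F (OY d a b c v) = Y (F v)"
proof -
  have qc: "q i \<in> Ocar d" for i
    by (induction i) (simp_all add: q0 q Ocar_lin Xc)
  show "clinear_on UNIV F"
    by (auto simp: clinear_on_def F_def fun_eq_iff algebra_simps sum.distrib sum_distrib_left)
  have "(\<Sum>j\<le>d. basis_vec 0 j * q j x) = (\<Sum>j\<le>d. if j = 0 then q j x else 0)" for x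
    by (intro sum.cong) (auto simp: basis_vec_def)
  then show "F (basis_vec 0) = q 0" by (simp add: F_def)
  show "F v \<in> Ocar d" using qc by (simp add: F_def Ocar_def)
  have Xq: "X (q i) = (\<lambda>x. Otheta d a i * q i x + q (Suc i) x)" for i
    by (simp add: q)
  have Xd: "X (q d) = (\<lambda>x. Otheta d a d * q d x)"
    using q_end Xq[of d] by simp
  note Yq = bidiagonal_chain[OF X Y q R[rule_format, OF qc] Y0 Y1]
  note hom = bidiagonal_hom[OF X Y \<open>even d\<close> Xq Xd Yq, folded F_def]
  show "v \<in> Ocar d \<Longrightarrow> F (OX d a v) = X (F v)" "v \<in> Ocar d \<Longrightarrow> F (OY d a b c v) = Y (F v)"
    unfolding F_def using hom by simp_all
qed

text \<open>A triple (s, A, B) says that the isomorphism carries A to s times B.\<close>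

definition siso :: "nat \<Rightarrow> (complex \<times> ((nat \<Rightarrow> complex) \<Rightarrow> nat \<Rightarrow> complex) \<times> ((nat \<Rightarrow> complex) \<Rightarrow> nat \<Rightarrow> complex)) set \<Rightarrow> bool" where
  "siso d S \<longleftrightarrow> (\<exists>f. clinear_on UNIV f \<and> bij_betw f (Ocar d) (Ocar d) \<and>
     (\<forall>(s, A, B) \<in> S. \<forall>v \<in> Ocar d. f (A v) = (\<lambda>x. s * B (f v) x)))"

lemma siso_trans:
  assumes "siso d S" "siso d T"
    and B: "\<And>s A B v. (s, A, B) \<in> S \<Longrightarrow> v \<in> Ocar d \<Longrightarrow> B v \<in> Ocar d"
    and U: "\<And>r A C. (r, A, C) \<in> U \<Longrightarrow> \<exists>s t B. r = s * t \<and> (s, A, B) \<in> S \<and> (t, B, C) \<in> T"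
  shows "siso d U"
proof -
  obtain f where f: "clinear_on UNIV f" "bij_betw f (Ocar d) (Ocar d)"
    and fS: "\<And>s A B v. (s, A, B) \<in> S \<Longrightarrow> v \<in> Ocar d \<Longrightarrow> f (A v) = (\<lambda>x. s * B (f v) x)"
    using assms(1) unfolding siso_def by fast
  obtain g where g: "clinear_on UNIV g" "bij_betw g (Ocar d) (Ocar d)"
    and gT: "\<And>s A B v. (s, A, B) \<in> T \<Longrightarrow> v \<in> Ocar d \<Longrightarrow> g (A v) = (\<lambda>x. s * B (g v) x)"
    using assms(2) unfolding siso_def by fast
  have "clinear_on UNIV (g \<circ> f)"
    using f(1) g(1) by (simp add: clinear_on_def)
  moreover have "bij_betw (g \<circ> f) (Ocar d) (Ocar d)"
    using f(2) g(2) by (rule bij_betw_trans)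
  moreover have "(g \<circ> f) (A v) = (\<lambda>x. r * C ((g \<circ> f) v) x)" if "(r, A, C) \<in> U" "v \<in> Ocar d" for r A C v
  proof -
    have fv: "f v \<in> Ocar d" using f(2) that(2) by (auto simp: bij_betw_def)
    have "\<exists>s t B. r = s * t \<and> (s, A, B) \<in> S \<and> (t, B, C) \<in> T" by (rule U[OF that(1)])
    then obtain s t B where *: "r = s * t" "(s, A, B) \<in> S" "(t, B, C) \<in> T" by blast
    show ?thesis
      using fS[OF *(2) that(2)] gT[OF *(3) fv] by (simp add: *(1) clinear_UNIV_scale[OF g(1)] mult.assoc)
  qed
  ultimately show ?thesis unfolding siso_def by blast
qed

lemma siso_mono: "siso d S \<Longrightarrow> U \<subseteq> S \<Longrightarrow> siso d U"
  unfolding siso_def by fast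

lemma siso_trans3:
  assumes "siso d {(s1, A1, B1), (s2, A2, B2), (s3, A3, B3)}"
    and "siso d {(t1, B1, C1), (t2, B2, C2), (t3, B3, C3)}"
    and "\<forall>v \<in> Ocar d. B1 v \<in> Ocar d \<and> B2 v \<in> Ocar d \<and> B3 v \<in> Ocar d"
  shows "siso d {(s1 * t1, A1, C1), (s2 * t2, A2, C2), (s3 * t3, A3, C3)}"
  by (rule siso_trans[OF assms(1,2)]) (use assms(3) in auto)

text \<open>Elimination of Z from the two relations of O_d(a,b,c).\<close>

lemma OX_power_relation:
  assumes "even d" "v \<in> Ocar d"
  shows "OX d a (OX d a (OY d a b c v)) x + 2 * OX d a (OY d a b c (OX d a v)) x + OY d a b c (OX d a (OX d a v)) x
    = OY d a b c v x + (2 * a * c - b * (of_nat d + 1)) * v x + 2 * (2 * a * b - c * (of_nat d + 1)) * OX d a v x"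
proof -
  have Z: "OZ d a b c u = (\<lambda>i. OX d a (OY d a b c u) i + OY d a b c (OX d a u) i - (2 * a * b - c * (of_nat d + 1)) * u i)" for u
    by (simp add: OZ_def fun_eq_iff)
  show ?thesis
    using OX_OZ[OF assms, of a b c x] unfolding Z clinear_UNIV_D[OF OX_linear]
    by (simp add: algebra_simps)
qed

text \<open>Eliminating Y instead yields the same cubic relation with b and c exchanged, which is
  what allows Z to take over the role of Y.\<close>

lemma OX_OZ_power_relation:
  assumes "even d" "v \<in> Ocar d"
  shows "OX d a (OX d a (OZ d a b c v)) x + 2 * OX d a (OZ d a b c (OX d a v)) x + OZ d a b c (OX d a (OX d a v)) x
    = OZ d a b c v x + (2 * a * b - c * (of_nat d + 1)) * v x + 2 * (2 * a * c - b * (of_nat d + 1)) * OX d a v x"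
proof -
  have "OX d a (\<lambda>i. OX d a (OZ d a b c v) i + OZ d a b c (OX d a v) i) x
    = OX d a (\<lambda>i. OY d a b c v i + (2 * a * c - b * (of_nat d + 1)) * v i) x"
    using OX_OZ[OF assms, of a b c] by presburger
  then have 1: "OX d a (OX d a (OZ d a b c v)) x
    = OX d a (OY d a b c v) x + (2 * a * c - b * (of_nat d + 1)) * OX d a v x - OX d a (OZ d a b c (OX d a v)) x"
    unfolding clinear_UNIV_D[OF OX_linear] by (simp add: eq_diff_eq)
  have 2: "OZ d a b c (OX d a (OX d a v)) x
    = OY d a b c (OX d a v) x + (2 * a * c - b * (of_nat d + 1)) * OX d a v x - OX d a (OZ d a b c (OX d a v)) x"
    using OX_OZ[OF assms(1) OX_car[of d a v], of a b c x] by (simp add: eq_diff_eq add.commute)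
  have 3: "OZ d a b c v x = OX d a (OY d a b c v) x + OY d a b c (OX d a v) x - (2 * a * b - c * (of_nat d + 1)) * v x"
    by (simp add: OZ_def)
  show ?thesis unfolding 1 2 3 by (simp add: algebra_simps)
qed

text \<open>On even rows Z has the constant diagonal entry c + d/2, so a vector supported on even indices is an
  eigenvector for it iff the neighbouring contributions to each odd row cancel. This is a two-step
  recursion, which stops at d because d is even.\<close>

fun even_chain :: "(nat \<Rightarrow> complex) \<Rightarrow> nat \<Rightarrow> complex" where
  "even_chain f 0 = 1"
| "even_chain f (Suc 0) = 0"
| "even_chain f (Suc (Suc i)) = even_chain f i / f (Suc (Suc i))"

lemma even_chain_odd: "odd i \<Longrightarrow> even_chain f i = 0"
  by (induction f i rule: even_chain.induct) auto

definition Ophi_nz :: "nat \<Rightarrow> complex \<Rightarrow> complex \<Rightarrow> complex \<Rightarrow> bool" where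
  "Ophi_nz d a b c \<longleftrightarrow> (\<forall>i. 1 \<le> i \<longrightarrow> i \<le> d \<longrightarrow> Ophi d a b c i \<noteq> 0)"

lemma Ophi_nzD: "Ophi_nz d a b c \<Longrightarrow> 1 \<le> i \<Longrightarrow> i \<le> d \<Longrightarrow> Ophi d a b c i \<noteq> 0"
  by (simp add: Ophi_nz_def)

definition OZ_vec :: "nat \<Rightarrow> complex \<Rightarrow> complex \<Rightarrow> complex \<Rightarrow> nat \<Rightarrow> complex" where
  "OZ_vec d a b c = (\<lambda>i. if i \<le> d then even_chain (Ophi d a b c) i else 0)"

lemma OZ_vec_car: "OZ_vec d a b c \<in> Ocar d"
  by (simp add: OZ_vec_def Ocar_def)

text \<open>In the second equation the odd rows agree by the recursion of \<open>even_chain\<close>,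
  and in even rows the diagonals of Y and X differ by the constant b - a. It trades Y for X when Z
  is later applied to X of this vector.\<close>

lemma OZ_vec:
  assumes "even d" and nz: "Ophi_nz d a b c"
  shows "OZ d a b c (OZ_vec d a b c) = (\<lambda>x. (c + of_nat d / 2) * OZ_vec d a b c x)" (is ?Z)
    and "OY d a b c (OZ_vec d a b c) = (\<lambda>x. OX d a (OZ_vec d a b c) x + (b - a) * OZ_vec d a b c x)" (is ?Y)
proof -
  let ?p = "OZ_vec d a b c"
  have rec: "Ophi d a b c (Suc (Suc i)) * ?p (Suc (Suc i)) = ?p i" if "even i" "Suc i \<le> d" for i
    using that Ophi_nzD[OF nz, of "Suc (Suc i)"] assms(1) by (cases "Suc i = d") (auto simp: OZ_vec_def)
  have odd0: "?p i = 0" if "odd i" for i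
    using that by (simp add: OZ_vec_def even_chain_odd)
  show ?Z
  proof
    fix x
    show "OZ d a b c ?p x = (c + of_nat d / 2) * ?p x"
    proof (cases "x \<le> d")
      case False
      then show ?thesis using OZ_car[OF OZ_vec_car, of d a b c a b c] by (auto simp: Ocar_def OZ_vec_def)
    next
      case True
      then show ?thesis
      proof (cases x)
        case 0
        then show ?thesis by (simp add: OZ_0[OF assms(1) OZ_vec_car] odd0 Ozeta_def)
      next
        case (Suc j)
        then show ?thesis
          using True by (cases "even j") (simp_all add: OZ_Suc[OF assms(1) OZ_vec_car] odd0 Ozeta_def rec mult.assoc)
      qed
    qed
  qed
  show ?Y
  proof
    fix x
    show "OY d a b c ?p x = OX d a ?p x + (b - a) * ?p x"
    proof (cases "x \<le> d")
      case False
      then show ?thesis using OY_car[of d a b c ?p] OX_car[of d a ?p] by (auto simp: Ocar_def OZ_vec_def)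
    next
      case True
      show ?thesis
      proof (cases x)
        case 0
        then show ?thesis
          by (simp add: OY_row[OF OZ_vec_car] OX_0 odd0 Otheta_def field_simps)
      next
        case (Suc j)
        then show ?thesis
          using True by (cases "even j") (simp_all add: OY_row[OF OZ_vec_car] OX_Suc odd0 rec Otheta_def field_simps)
      qed
    qed
  qed
qed

section \<open>Isomorphisms that negate or exchange generators\<close>

lemma Otheta_reverse:
  assumes "even d" "i \<le> d"
  shows "Otheta d (- a) (d - i) = - Otheta d a i"
  using assms by (auto simp: Otheta_def of_nat_diff minus_one_power_iff field_simps)

text \<open>The chain applies the factors OX - theta_i in descending order; since they commute, it ends in 0
  exactly as the ascending one does.\<close>

lemma OX_chain_reverse:
  assumes "even d" and q: "\<And>i. q (Suc i) = (\<lambda>x. - OX d a (q i) x - Otheta d (- a) i * q i x)"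
    and q0: "q 0 \<in> Ocar d"
  shows "q (Suc d) = (\<lambda>x. 0)"
proof -
  define T where "T l v = (\<lambda>x. OX d a v x - Otheta d a l * v x)" for l v
  define P where "P = rec_nat (\<lambda>v. v) (\<lambda>j p v. T j (p v))"
  have P: "P 0 v = v" "P (Suc j) v = T j (P j v)" for j v by (simp_all add: P_def)
  note lin = clinear_UNIV_D[OF OX_linear] clinear_UNIV_uminus[OF OX_linear]
  have TT: "T l (T m v) = T m (T l v)" for l m v
    unfolding T_def lin by (auto simp: algebra_simps)
  have T0: "T l (\<lambda>x. 0) = (\<lambda>x. 0)" "T l (\<lambda>x. - v x) = (\<lambda>x. - T l v x)" for l v
    by (simp_all add: T_def lin)
  have PT: "P j (T l v) = T l (P j v)" for j l v
    by (induction j) (simp_all add: P TT)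
  have Pm: "P j (\<lambda>x. - v x) = (\<lambda>x. - P j v x)" for j v
    by (induction j) (simp_all add: P T0)
  have Pc: "v \<in> Ocar d \<Longrightarrow> P j v \<in> Ocar d" for j v
    by (induction j) (auto simp: P T_def intro!: Ocar_lin OX_car)
  \<comment> \<open>Each factor X - theta_j clears one further coordinate from below, since X is
    lower bidiagonal.\<close>
  have low: "v \<in> Ocar d \<Longrightarrow> x < j \<Longrightarrow> P j v x = 0" for j v x
  proof (induction j arbitrary: x)
    case (Suc j)
    have "P j v (d + 1) = 0" using Pc[OF Suc(2), of j] by (simp add: Ocar_def)
    moreover have "P j v x = 0" if "x > d" for x using Pc[OF Suc(2), of j] that by (simp add: Ocar_def)
    ultimately show ?case using Suc by (cases "x = j") (auto simp: P T_def OX_def)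
  qed simp
  \<comment> \<open>Up to sign, q_i already contains the i factors with the largest indices, and
    \<open>P (Suc d - i)\<close> supplies the remaining ones; the full product is zero.\<close>
  have "i \<le> Suc d \<Longrightarrow> P (Suc d - i) (q i) = (\<lambda>x. 0)" for i
  proof (induction i)
    case 0
    have "P (Suc d) (q 0) x = 0" for x
      using low[OF q0, of x "Suc d"] Pc[OF q0, of "Suc d"] by (cases "x < Suc d") (auto simp: Ocar_def)
    then show ?case by auto
  next
    case (Suc i)
    have "q (Suc i) = (\<lambda>x. - T (d - i) (q i) x)"
      using Otheta_reverse[of d i "-a"] Otheta_reverse[of d "d - i" "-a"] Suc(2) assms(1) by (simp add: q T_def)
    moreover have "Suc d - i = Suc (d - i)" using Suc(2) by simp
    ultimately show ?case
      using Suc by (simp add: Pm PT P)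
  qed
  from this[of "Suc d"] show ?thesis by (simp add: P)
qed

text \<open>The eigenvalues of -X are those belonging to the parameter -a in reverse order, and
  negating X turns the two scalars of the relations into those of (-a,b,-c). Hence
  \<open>basis_vec 0\<close> itself serves as generator.\<close>

lemma O_sign_hom:
  assumes "even d"
  obtains F where "clinear_on UNIV F" "F (basis_vec 0) = basis_vec 0" "\<And>v. F v \<in> Ocar d"
    "\<And>v. v \<in> Ocar d \<Longrightarrow> F (OX d (- a) v) = (\<lambda>x. - OX d a (F v) x)"
    "\<And>v. v \<in> Ocar d \<Longrightarrow> F (OY d (- a) b (- c) v) = OY d a b c (F v)"
proof -
  define q where "q = rec_nat (basis_vec 0) (\<lambda>i u x. - OX d a u x - Otheta d (- a) i * u x)"
  have q: "q 0 = basis_vec 0" "\<And>i. q (Suc i) = (\<lambda>x. - OX d a (q i) x - Otheta d (- a) i * q i x)"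
    by (simp_all add: q_def)
  have q0: "q 0 \<in> Ocar d" by (simp add: q basis_vec_car)
  note qe = OX_chain_reverse[OF assms q(2) q0]
  have X: "clinear_on UNIV (\<lambda>v x. - OX d a v x)"
    using OX_linear[of d a] by (simp add: clinear_on_def)
  have R: "\<forall>v\<in>Ocar d. \<forall>x. - OX d a (\<lambda>x. - OX d a (OY d a b c v) x) x + 2 * - OX d a (OY d a b c (\<lambda>x. - OX d a v x)) x
       + OY d a b c (\<lambda>x. - OX d a (\<lambda>x. - OX d a v x) x) x
      = OY d a b c v x + (2 * (-a) * (-c) - b * (of_nat d + 1)) * v x
        + 2 * (2 * (-a) * b - (-c) * (of_nat d + 1)) * - OX d a v x"
    using OX_power_relation[OF assms]
    by (simp add: clinear_UNIV_uminus[OF OX_linear] clinear_UNIV_uminus[OF OY_linear] algebra_simps)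
  have Y0: "OY d a b c (q 0) = (\<lambda>x. Otheta d b 0 * q 0 x)"
    by (rule ext) (simp only: OY_row[OF q0], simp add: q basis_vec_def)
  have Y1: "OY d a b c (q 1) = (\<lambda>x. Otheta d b 1 * q 1 x + Ophi d (- a) b (- c) 1 * q 0 x)"
  proof (cases "d = 0")
    case True
    then show ?thesis
      using qe by (auto simp: q basis_vec_def OY_def OX_def Otheta_def Ophi_def fun_eq_iff)
  next
    case False
    \<comment> \<open>The entry d in row 0 is -theta_0 for a minus theta_0 for -a.\<close>
    have q1: "q (Suc 0) = (\<lambda>x. if x = 0 then of_nat d else if x = 1 then - 1 else 0)"
      using False by (auto simp: q basis_vec_def OX_def Otheta_def fun_eq_iff field_simps)
    show ?thesis
    proof
      fix x :: nat
      consider "x = 0" | "x = 1" | "x > 1" by linarith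
      then show "OY d a b c (q 1) x = Otheta d b 1 * q 1 x + Ophi d (- a) b (- c) 1 * q 0 x"
        using False by cases (auto simp: q1 q(1) basis_vec_def OY_def Otheta_def Ophi_def field_simps)
    qed
  qed
  have Xc: "\<forall>v\<in>Ocar d. (\<lambda>x. - OX d a v x) \<in> Ocar d"
    by (intro ballI Ocar_lin OX_car)
  note U = O_universal[OF X OY_linear assms Xc R q(2) q0 qe Y0 Y1]
  show thesis
    by (rule that[OF U(1) _ U(3) U(4) U(5)]) (simp_all add: U(2) q(1))
qed

text \<open>Negating the parameters twice restores them, so the same construction also gives a map
  backwards; both composites commute with X and fix its cyclic vector.\<close>

lemma siso_sign:
  assumes "even d"
  shows "siso d {(-1, OX d a, OX d (- a)), (1, OY d a b c, OY d (- a) b (- c)), (-1, OZ d a b c, OZ d (- a) b (- c))}"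
proof -
  obtain F where F: "clinear_on UNIV F" "F (basis_vec 0) = basis_vec 0" "\<And>v. F v \<in> Ocar d"
    "\<And>v. v \<in> Ocar d \<Longrightarrow> F (OX d (- a) v) = (\<lambda>x. - OX d a (F v) x)"
    "\<And>v. v \<in> Ocar d \<Longrightarrow> F (OY d (- a) b (- c) v) = OY d a b c (F v)"
    by (rule O_sign_hom[OF assms, of a b c]) (rule that)
  obtain G where G: "clinear_on UNIV G" "G (basis_vec 0) = basis_vec 0" "\<And>v. G v \<in> Ocar d"
    "\<And>v. v \<in> Ocar d \<Longrightarrow> G (OX d a v) = (\<lambda>x. - OX d (- a) (G v) x)"
    "\<And>v. v \<in> Ocar d \<Longrightarrow> G (OY d a b c v) = OY d (- a) b (- c) (G v)"
    by (rule O_sign_hom[OF assms, of "- a" b "- c", unfolded minus_minus]) (rule that)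
  have FG: "F (G v) = v" if "v \<in> Ocar d" for v
    by (rule OX_cyclic[of d "F \<circ> G" a, unfolded comp_def])
      (use F G that in \<open>auto simp: clinear_UNIV_uminus[OF F(1)] clinear_on_def\<close>)
  have GF: "G (F v) = v" if "v \<in> Ocar d" for v
    by (rule OX_cyclic[of d "G \<circ> F" "- a", unfolded comp_def])
      (use F G that in \<open>auto simp: clinear_UNIV_uminus[OF G(1)] clinear_on_def\<close>)
  have "bij_betw G (Ocar d) (Ocar d)"
    using FG GF F(3) G(3) by (intro bij_betw_byWitness[where f' = F]) auto
  moreover have "G (OZ d a b c v) = (\<lambda>x. - OZ d (- a) b (- c) (G v) x)" if "v \<in> Ocar d" for v
    unfolding OZ_def clinear_UNIV_D[OF G(1)] G(4)[OF OY_car] G(4)[OF that] G(5)[OF OX_car] G(5)[OF that]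
    by (simp add: clinear_UNIV_uminus[OF OY_linear] algebra_simps)
  ultimately show ?thesis
    unfolding siso_def using G by (intro exI[of _ G]) auto
qed

text \<open>The generator is the Z-eigenvector \<open>OZ_vec\<close>: its eigenvalue under -Z is the
  first eigenvalue for the parameter -c. Equality of the 0-th coordinates is recorded because it
  later pins down the composite of two such maps.\<close>

lemma O_swap_hom:
  assumes "even d" and nz: "Ophi_nz d a b c"
  obtains F where "clinear_on UNIV F" "\<And>v. F v \<in> Ocar d"
    "\<And>v. v \<in> Ocar d \<Longrightarrow> F v 0 = v 0"
    "\<And>v. v \<in> Ocar d \<Longrightarrow> F (OX d a v) = OX d a (F v)"
    "\<And>v. v \<in> Ocar d \<Longrightarrow> F (OY d a (- c) (- b) v) = (\<lambda>x. - OZ d a b c (F v) x)"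
    "\<And>v. v \<in> Ocar d \<Longrightarrow> F (OZ d a (- c) (- b) v) = (\<lambda>x. - OY d a b c (F v) x)"
proof -
  let ?p = "OZ_vec d a b c"
  define q where "q = rec_nat ?p (\<lambda>i u x. OX d a u x - Otheta d a i * u x)"
  have q: "q 0 = ?p" "\<And>i. q (Suc i) = (\<lambda>x. OX d a (q i) x - Otheta d a i * q i x)"
    by (simp_all add: q_def)
  have q0: "q 0 \<in> Ocar d" by (simp add: q OZ_vec_car)
  have qc: "q i \<in> Ocar d" for i
    by (induction i) (simp_all add: q OZ_vec_car Ocar_lin OX_car)
  have low: "x < j \<Longrightarrow> q j x = 0" for j x
  proof (induction j arbitrary: x)
    case (Suc j)
    moreover have "q j x = 0" if "x > d" for x using qc[of j] that by (simp add: Ocar_def)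
    ultimately show ?case by (cases "x = j") (auto simp: q OX_def)
  qed simp
  have qe: "q (Suc d) = (\<lambda>x. 0)"
  proof
    show "q (Suc d) x = 0" for x
      using low[of x "Suc d"] qc[of "Suc d"] by (cases "x < Suc d") (auto simp: Ocar_def)
  qed
  have Y: "clinear_on UNIV (\<lambda>v x. - OZ d a b c v x)"
    using OZ_linear[of d a b c] by (simp add: clinear_on_def)
  have R: "\<forall>v\<in>Ocar d. \<forall>x. OX d a (OX d a (\<lambda>x. - OZ d a b c v x)) x + 2 * OX d a (\<lambda>x. - OZ d a b c (OX d a v) x) x
       + - OZ d a b c (OX d a (OX d a v)) x
      = - OZ d a b c v x + (2 * a * (-b) - (-c) * (of_nat d + 1)) * v x
        + 2 * (2 * a * (-c) - (-b) * (of_nat d + 1)) * OX d a v x"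
    using OX_OZ_power_relation[OF assms(1)]
    by (simp add: clinear_UNIV_uminus[OF OX_linear] algebra_simps)
  have Zp: "OZ d a b c ?p = (\<lambda>x. (c + of_nat d / 2) * ?p x)"
    "OY d a b c ?p = (\<lambda>x. OX d a ?p x + (b - a) * ?p x)"
    by (fact OZ_vec[OF assms])+
  have Y0: "(\<lambda>x. - OZ d a b c (q 0) x) = (\<lambda>x. Otheta d (- c) 0 * q 0 x)"
    by (auto simp: q Zp Otheta_def field_simps)
  \<comment> \<open>The relation for {X,Z} moves Z past X, and the Y-term it leaves is expressed
    through X by the second equation of \<open>OZ_vec\<close>.\<close>
  have ZXp: "OZ d a b c (OX d a ?p) x
      = OX d a ?p x + (b - a) * ?p x + (2 * a * c - b * (of_nat d + 1)) * ?p x - (c + of_nat d / 2) * OX d a ?p x" for x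
    using OX_OZ[OF assms(1) OZ_vec_car[of d a b c], of a b c x]
    unfolding Zp clinear_UNIV_D[OF OX_linear] by (simp add: algebra_simps)
  have Y1: "(\<lambda>x. - OZ d a b c (q 1) x) = (\<lambda>x. Otheta d (- c) 1 * q 1 x + Ophi d a (- c) (- b) 1 * q 0 x)"
    unfolding One_nat_def q clinear_UNIV_D[OF OZ_linear] ZXp Zp
    by (simp add: fun_eq_iff Otheta_def Ophi_def field_simps)
  have Xc: "\<forall>v\<in>Ocar d. OX d a v \<in> Ocar d"
    by (intro ballI OX_car)
  define F where "F = (\<lambda>v x. \<Sum>j\<le>d. v j * q j x)"
  note univ = O_universal[OF OX_linear Y assms(1) Xc R q(2) q0 qe Y0 Y1]
  have U: "clinear_on UNIV F" "F (basis_vec 0) = q 0" "\<And>v. F v \<in> Ocar d"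
    "\<And>v. v \<in> Ocar d \<Longrightarrow> F (OX d a v) = OX d a (F v)"
    "\<And>v. v \<in> Ocar d \<Longrightarrow> F (OY d a (- c) (- b) v) = (\<lambda>x. - OZ d a b c (F v) x)"
    unfolding F_def by (fact univ)+
  \<comment> \<open>Only q_0 has a nonzero coordinate at 0, and there it equals 1.\<close>
  have F0: "F v 0 = v 0" for v
  proof -
    have "F v 0 = (\<Sum>j\<le>d. if j = 0 then v 0 else 0)"
      unfolding F_def by (intro sum.cong) (auto simp: low q OZ_vec_def)
    then show ?thesis by simp
  qed
  have Z: "F (OZ d a (- c) (- b) v) = (\<lambda>x. - OY d a b c (F v) x)" if "v \<in> Ocar d" for v
  proof
    fix x
    have "F (OZ d a (- c) (- b) v) x = - OX d a (OZ d a b c (F v)) x - OZ d a b c (OX d a (F v)) x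
        + (2 * a * c - b * (of_nat d + 1)) * F v x"
      unfolding OZ_def[of d a "- c" "- b"] clinear_UNIV_D[OF U(1)] U(4)[OF OY_car] U(4)[OF that] U(5)[OF OX_car] U(5)[OF that]
      by (simp add: clinear_UNIV_uminus[OF OX_linear] algebra_simps)
    also have "\<dots> = - OY d a b c (F v) x"
      using OX_OZ[OF assms(1) U(3)[of v], of a b c x] by (simp add: algebra_simps)
    finally show "F (OZ d a (- c) (- b) v) x = - OY d a b c (F v) x" .
  qed
  show thesis
    by (rule that[OF U(1) U(3) F0 U(4) U(5) Z]) auto
qed

lemma OY_eigenvector_unique:
  assumes nz: "Ophi_nz d a b c" and w: "w \<in> Ocar d"
    and eig: "OY d a b c w = (\<lambda>x. Otheta d b 0 * w x)"
  shows "w = (\<lambda>x. w 0 * basis_vec 0 x)"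
proof -
  have "w (Suc i) = 0" for i
  proof (induction i)
    case 0
    have "Ophi d a b c 1 * w 1 = 0"
      using fun_cong[OF eig, of 0] by (simp add: OY_row[OF w])
    then show ?case using Ophi_nzD[OF nz, of 1] w by (cases "1 \<le> d") (auto simp: Ocar_def)
  next
    case (Suc i)
    have "Ophi d a b c (Suc (Suc i)) * w (Suc (Suc i)) = 0"
      using fun_cong[OF eig, of "Suc i"] Suc by (simp add: OY_row[OF w])
    then show ?case using Ophi_nzD[OF nz, of "Suc (Suc i)"] w by (cases "Suc (Suc i) \<le> d") (auto simp: Ocar_def)
  qed
  then have "w i = 0" if "i \<noteq> 0" for i using that by (cases i) auto
  then show ?thesis by (auto simp: basis_vec_def)
qed

text \<open>F o G maps the first basis vector to an eigenvector of Y with the same 0-th coordinate. That eigenspace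
  is one-dimensional, so F o G fixes this cyclic vector of X.\<close>

lemma O_swap_inverse:
  assumes nz: "Ophi_nz d a b c"
    and F: "clinear_on UNIV F" "\<And>v. F v \<in> Ocar d" "\<And>v. v \<in> Ocar d \<Longrightarrow> F v 0 = v 0"
    "\<And>v. v \<in> Ocar d \<Longrightarrow> F (OX d a v) = OX d a (F v)"
    "\<And>v. v \<in> Ocar d \<Longrightarrow> F (OZ d a (- c) (- b) v) = (\<lambda>x. - OY d a b c (F v) x)"
    and G: "clinear_on UNIV G" "\<And>v. G v \<in> Ocar d" "\<And>v. v \<in> Ocar d \<Longrightarrow> G v 0 = v 0"
    "\<And>v. v \<in> Ocar d \<Longrightarrow> G (OX d a v) = OX d a (G v)"
    "\<And>v. v \<in> Ocar d \<Longrightarrow> G (OY d a b c v) = (\<lambda>x. - OZ d a (- c) (- b) (G v) x)"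
    and v: "v \<in> Ocar d"
  shows "F (G v) = v"
proof -
  let ?e = "basis_vec 0" and ?w = "F (G (basis_vec 0))"
  have e: "?e \<in> Ocar d" by (simp add: basis_vec_car)
  have "OY d a b c ?e = (\<lambda>x. Otheta d b 0 * ?e x)"
    by (rule ext) (simp only: OY_row[OF e], simp add: basis_vec_def)
  then have "F (G (OY d a b c ?e)) = (\<lambda>x. Otheta d b 0 * ?w x)"
    by (simp add: clinear_UNIV_D[OF F(1)] clinear_UNIV_D[OF G(1)])
  then have "OY d a b c ?w = (\<lambda>x. Otheta d b 0 * ?w x)"
    by (simp add: G(5)[OF e] clinear_UNIV_uminus[OF F(1)] F(5)[OF G(2)])
  note w = OY_eigenvector_unique[OF nz F(2) this]
  have "?w 0 = 1"
    unfolding F(3)[OF G(2)] G(3)[OF e] by (simp add: basis_vec_def)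
  then have "(\<lambda>x. ?w 0 * ?e x) = ?e" by simp
  with w have "?w = ?e" by (rule trans)
  show ?thesis
  proof (rule OX_cyclic[of d "\<lambda>v. F (G v)" a])
    show "clinear_on UNIV (\<lambda>v. F (G v))"
      using F(1) G(1) by (simp add: clinear_on_def)
  qed (fact | simp add: F(4) G(2) G(4))+
qed

lemma siso_swap23:
  assumes "even d" and nz: "Ophi_nz d a b c"
    and nz': "Ophi_nz d a (- c) (- b)"
  shows "siso d {(1, OX d a, OX d a), (-1, OY d a b c, OZ d a (- c) (- b)), (-1, OZ d a b c, OY d a (- c) (- b))}"
proof -
  obtain F where F: "clinear_on UNIV F" "\<And>v. F v \<in> Ocar d" "\<And>v. v \<in> Ocar d \<Longrightarrow> F v 0 = v 0"
    "\<And>v. v \<in> Ocar d \<Longrightarrow> F (OX d a v) = OX d a (F v)"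
    "\<And>v. v \<in> Ocar d \<Longrightarrow> F (OY d a (- c) (- b) v) = (\<lambda>x. - OZ d a b c (F v) x)"
    "\<And>v. v \<in> Ocar d \<Longrightarrow> F (OZ d a (- c) (- b) v) = (\<lambda>x. - OY d a b c (F v) x)"
    by (rule O_swap_hom[OF assms(1) nz]) (rule that)
  obtain G where G: "clinear_on UNIV G" "\<And>v. G v \<in> Ocar d" "\<And>v. v \<in> Ocar d \<Longrightarrow> G v 0 = v 0"
    "\<And>v. v \<in> Ocar d \<Longrightarrow> G (OX d a v) = OX d a (G v)"
    "\<And>v. v \<in> Ocar d \<Longrightarrow> G (OY d a b c v) = (\<lambda>x. - OZ d a (- c) (- b) (G v) x)"
    "\<And>v. v \<in> Ocar d \<Longrightarrow> G (OZ d a b c v) = (\<lambda>x. - OY d a (- c) (- b) (G v) x)"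
    by (rule O_swap_hom[OF assms(1) nz', unfolded minus_minus]) (rule that)
  have FG: "F (G v) = v" if "v \<in> Ocar d" for v
    using O_swap_inverse[OF nz F(1-4) F(6) G(1-5) that] .
  have GF: "G (F v) = v" if "v \<in> Ocar d" for v
    using O_swap_inverse[of d a "- c" "- b" G F v] nz' F G that by simp
  have "bij_betw G (Ocar d) (Ocar d)"
    using FG GF F(2) G(2) by (intro bij_betw_byWitness[where f' = F]) auto
  then show ?thesis
    unfolding siso_def using G by (intro exI[of _ G]) auto
qed

lemma Ophi_reverse:
  assumes "even d" "i \<le> d"
  shows "Ophi d (- b) (- a) c (Suc i) = Ophi d a b c (d - i)"
  using assms by (cases "even i") (auto simp: Ophi_def of_nat_diff field_simps)

text \<open>Reversing the basis turns upper into lower bidiagonal matrices. The new lower matrix is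
  that of -Y, whose entries are the phi_i; the factors \<open>l\<close> normalise them, which is
  where the phi_i are divided by.\<close>

lemma siso_swap12:
  assumes "even d" and nz: "Ophi_nz d a b c"
  shows "siso d {(-1, OX d a, OY d (- b) (- a) c), (-1, OY d a b c, OX d (- b)), (1, OZ d a b c, OZ d (- b) (- a) c)}"
proof -
  define l where "l = rec_nat 1 (\<lambda>i y. y / - Ophi d a b c (d - i))"
  have l: "l 0 = 1" "l (Suc i) = l i / - Ophi d a b c (d - i)" for i by (simp_all add: l_def)
  have lnz: "i \<le> d \<Longrightarrow> l i \<noteq> 0" for i
    by (induction i) (auto simp: l Ophi_nzD[OF nz])
  define f where "f v i = (if i \<le> d then l i * v (d - i) else 0)" for v i
  have fl: "clinear_on UNIV f" by (auto simp: clinear_on_def f_def fun_eq_iff algebra_simps)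
  have fc: "f v \<in> Ocar d" for v by (simp add: f_def Ocar_def)
  have lP: "Ophi d a b c (d - i) * l (Suc i) = - l i" if "i < d" for i
    using Ophi_nzD[OF nz, of "d - i"] that by (simp add: l)
  have fX: "f (OX d a v) = (\<lambda>x. - OY d (- b) (- a) c (f v) x)" for v
  proof
    fix x
    show "f (OX d a v) x = - OY d (- b) (- a) c (f v) x"
    proof (cases "x \<le> d")
      case False
      then show ?thesis by (simp add: f_def OY_def)
    next
      case True
      have e: "Otheta d (- a) x = - Otheta d a (d - x)"
        using Otheta_reverse[of d "d - x" a] assms(1) True by simp
      show ?thesis
      proof (cases "x = d")
        case True
        then show ?thesis using e assms(1) by (simp add: f_def OX_0 OY_def)
      next
        case False
        then have x: "x < d" "d - x = Suc (d - Suc x)" using True by auto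
        have "OX d a v (d - x) = Otheta d a (d - x) * v (d - x) + v (d - Suc x)"
          unfolding x(2) by (rule OX_Suc) (use x in simp)
        then have "f (OX d a v) x = l x * (Otheta d a (d - x) * v (d - x) + v (d - Suc x))"
          using True by (simp add: f_def)
        also have "\<dots> = - (Otheta d (- a) x * f v x + (Ophi d a b c (d - x) * l (Suc x)) * v (d - Suc x))"
          using True unfolding lP[OF x(1)] e by (simp add: f_def algebra_simps)
        also have "\<dots> = - OY d (- b) (- a) c (f v) x"
          unfolding OY_row[OF fc] Ophi_reverse[OF assms(1) True] using x(1) by (simp add: f_def)
        finally show ?thesis .
      qed
    qed
  qed
  have fY: "f (OY d a b c v) = (\<lambda>x. - OX d (- b) (f v) x)" if v: "v \<in> Ocar d" for v
  proof
    fix x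
    show "f (OY d a b c v) x = - OX d (- b) (f v) x"
    proof (cases "x \<le> d")
      case False
      then show ?thesis by (simp add: f_def OX_def)
    next
      case True
      have e: "Otheta d (- b) x = - Otheta d b (d - x)"
        using Otheta_reverse[of d "d - x" b] assms(1) True by simp
      show ?thesis
      proof (cases x)
        case 0
        then show ?thesis using e assms(1) by (simp add: f_def OX_0 OY_def)
      next
        case (Suc y)
        then have y: "y < d" "Suc (d - x) = d - y" using True by auto
        have "f (OY d a b c v) x = l x * (Otheta d b (d - x) * v (d - x) + Ophi d a b c (d - y) * v (d - y))"
          using True by (simp add: f_def OY_row[OF v] y(2))
        also have "\<dots> = l x * Otheta d b (d - x) * v (d - x) + (Ophi d a b c (d - y) * l (Suc y)) * v (d - y)"
          by (simp add: Suc algebra_simps)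
        also have "\<dots> = - (Otheta d (- b) x * f v x + f v y)"
          using True y(1) unfolding lP[OF y(1)] e by (simp add: f_def)
        also have "\<dots> = - OX d (- b) (f v) x"
          using True Suc by (simp add: OX_Suc)
        finally show ?thesis .
      qed
    qed
  qed
  have fZ: "f (OZ d a b c v) = OZ d (- b) (- a) c (f v)" if v: "v \<in> Ocar d" for v
    unfolding OZ_def clinear_UNIV_D[OF fl] fX fY[OF v] fY[OF OX_car]
      clinear_UNIV_uminus[OF OX_linear] clinear_UNIV_uminus[OF OY_linear]
    by (simp add: algebra_simps)
  have "bij_betw f (Ocar d) (Ocar d)"
  proof (rule bij_betw_byWitness[where f' = "\<lambda>v i. if i \<le> d then v (d - i) / l (d - i) else 0"])
    show "\<forall>v\<in>Ocar d. (\<lambda>i. if i \<le> d then f v (d - i) / l (d - i) else 0) = v"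
      using lnz by (auto simp: f_def Ocar_def fun_eq_iff)
    show "\<forall>v\<in>Ocar d. f (\<lambda>i. if i \<le> d then v (d - i) / l (d - i) else 0) = v"
      using lnz by (auto simp: f_def Ocar_def fun_eq_iff)
  qed (auto simp: fc, auto simp: Ocar_def)
  then show ?thesis
    unfolding siso_def using fl fX fY fZ by (intro exI[of _ f]) auto
qed

section \<open>Irreducibility\<close>

lemma csubspace_of_D:
  assumes "csubspace_of U"
  shows "(\<lambda>x. 0) \<in> U"
    and "u \<in> U \<Longrightarrow> w \<in> U \<Longrightarrow> (\<lambda>x. u x + w x) \<in> U"
    and "u \<in> U \<Longrightarrow> (\<lambda>x. e * u x) \<in> U"
    and "u \<in> U \<Longrightarrow> w \<in> U \<Longrightarrow> (\<lambda>x. u x - e * w x) \<in> U"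
proof -
  have l: "(\<lambda>x. e * u x + w x) \<in> U" if "u \<in> U" "w \<in> U" for e u w
    using assms that unfolding csubspace_of_def by blast
  show z: "(\<lambda>x. 0) \<in> U" using assms by (simp add: csubspace_of_def)
  show "u \<in> U \<Longrightarrow> w \<in> U \<Longrightarrow> (\<lambda>x. u x + w x) \<in> U" using l[of u w 1] by simp
  show "u \<in> U \<Longrightarrow> (\<lambda>x. e * u x) \<in> U" using l[OF _ z, of u e] by simp
  show "u \<in> U \<Longrightarrow> w \<in> U \<Longrightarrow> (\<lambda>x. u x - e * w x) \<in> U" using l[of w u "- e"] by simp
qed

lemma csubspace_of_sum:
  assumes "csubspace_of U" "finite J" "\<And>j. j \<in> J \<Longrightarrow> q j \<in> U"
  shows "(\<lambda>x. \<Sum>j\<in>J. v j * q j x) \<in> U"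
  using assms(2,3) by induction (auto intro!: csubspace_of_D[OF assms(1)])

lemma O_ops_car:
  assumes "A \<in> {OX d e, OY d e f g, OZ d e f g}" "B \<in> {OX d e, OY d e f g, OZ d e f g}"
    "C \<in> {OX d e, OY d e f g, OZ d e f g}"
  shows "\<forall>v\<in>Ocar d. A v \<in> Ocar d \<and> B v \<in> Ocar d \<and> C v \<in> Ocar d"
  using assms by (auto simp: OX_car OY_car OZ_car)

text \<open>Exchange of X and Y, negation, exchange back: X stays and Y changes sign. The first
  basis vector of the target thus pulls back to an eigenvector of Y for its last eigenvalue that is
  still cyclic for X.\<close>

lemma siso_reverse_Y:
  assumes "even d" "Ophi_nz d a b c" "Ophi_nz d b (- a) (- c)"
  shows "siso d {(1, OX d a, OX d a), (-1, OY d a b c, OY d a (- b) (- c))}"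
proof -
  have 1: "siso d {(1, OY d (- b) (- a) c, OY d b (- a) (- c)), (-1, OX d (- b), OX d b),
      (-1, OZ d (- b) (- a) c, OZ d b (- a) (- c))}"
    by (rule siso_mono[OF siso_sign[OF assms(1), of "- b" "- a" c]]) auto
  have 2: "siso d {(-1, OY d b (- a) (- c), OX d a), (-1, OX d b, OY d a (- b) (- c)),
      (1, OZ d b (- a) (- c), OZ d a (- b) (- c))}"
    by (rule siso_mono[OF siso_swap12[OF assms(1,3)]]) auto
  from siso_trans3[OF siso_trans3[OF siso_swap12[OF assms(1,2)] 1 O_ops_car] 2 O_ops_car] show ?thesis
    by (rule siso_mono) auto
qed

lemma O_contains_top_vector:
  assumes U: "csubspace_of U" "U \<subseteq> Ocar d" and inv: "\<And>u. u \<in> U \<Longrightarrow> OX d a u \<in> U"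
    and u: "u \<in> U" "u i \<noteq> 0"
  shows "\<exists>w \<in> U. w d \<noteq> 0"
proof -
  have "\<exists>w \<in> U. w i \<noteq> 0 \<Longrightarrow> i \<le> d \<Longrightarrow> \<exists>w \<in> U. w d \<noteq> 0" for i
  proof (induction "d - i" arbitrary: i)
    case (Suc m)
    then obtain w where w: "w \<in> U" "w i \<noteq> 0" by blast
    have i: "Suc i \<le> d" using Suc(2) by simp
    have "\<exists>w \<in> U. w (Suc i) \<noteq> 0"
    proof (cases "w (Suc i) = 0")
      case True
      then have "OX d a w (Suc i) \<noteq> 0" using w i by (simp add: OX_Suc)
      then show ?thesis using inv[OF w(1)] by blast
    qed (use w in blast)
    then show ?case using Suc(1)[of "Suc i"] Suc(2) i by simp
  qed auto
  moreover have "i \<le> d" using u U(2) by (auto simp: Ocar_def not_less[symmetric])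
  ultimately show ?thesis using u by blast
qed

lemma O_irreducible:
  assumes "even d" and nz: "Ophi_nz d a b c" and nz': "Ophi_nz d b (- a) (- c)"
    and dist: "\<And>j. j < d \<Longrightarrow> Otheta d b j \<noteq> Otheta d b d"
    and U: "csubspace_of U" "U \<subseteq> Ocar d" "U \<noteq> {\<lambda>_. 0}"
    and invX: "\<And>u. u \<in> U \<Longrightarrow> OX d a u \<in> U" and invY: "\<And>u. u \<in> U \<Longrightarrow> OY d a b c u \<in> U"
  shows "U = Ocar d"
proof -
  note sub = csubspace_of_D[OF U(1)]
  obtain f where f: "clinear_on UNIV f" "bij_betw f (Ocar d) (Ocar d)"
    "\<And>v. v \<in> Ocar d \<Longrightarrow> f (OX d a v) = OX d a (f v)"
    "\<And>v. v \<in> Ocar d \<Longrightarrow> f (OY d a b c v) = (\<lambda>x. - OY d a (- b) (- c) (f v) x)"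
    using siso_reverse_Y[OF assms(1) nz nz'] unfolding siso_def by auto
  note flin = clinear_UNIV_D[OF f(1)]
  have e0: "basis_vec 0 \<in> Ocar d" by (simp add: basis_vec_car)
  then obtain y where y: "y \<in> Ocar d" "f y = basis_vec 0"
    using f(2) by (metis bij_betw_def imageE)
  let ?\<theta> = "Otheta d b d"
  have t: "- Otheta d (- b) 0 = ?\<theta>" using assms(1) by (simp add: Otheta_def field_simps)
  have "OY d a (- b) (- c) (basis_vec 0) = (\<lambda>x. Otheta d (- b) 0 * basis_vec 0 x)"
    by (rule ext) (simp only: OY_row[OF e0], simp add: basis_vec_def)
  then have "f (OY d a b c y) = f (\<lambda>x. ?\<theta> * y x)"
    unfolding f(4)[OF y(1)] flin y(2) t[symmetric] by simp
  then have Yy: "OY d a b c y = (\<lambda>x. ?\<theta> * y x)"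
    using f(2) OY_car Ocar_lin(3)[OF y(1)] by (auto simp: bij_betw_def dest: inj_onD)
  \<comment> \<open>Y is upper bidiagonal, so a zero top coordinate propagates downwards: row j
    reduces to (theta*_j - theta*_d) y_j = 0, and the eigenvalues differ.\<close>
  have yd: "y d \<noteq> 0"
  proof
    assume "y d = 0"
    have "i \<le> d \<Longrightarrow> y (d - i) = 0" for i
    proof (induction i)
      case (Suc i)
      have "d - i = Suc (d - Suc i)" using Suc(2) by simp
      then have "(Otheta d b (d - Suc i) - ?\<theta>) * y (d - Suc i) = 0"
        using fun_cong[OF Yy, of "d - Suc i"] Suc by (simp add: OY_row[OF y(1)] algebra_simps)
      then show ?case using dist[of "d - Suc i"] Suc(2) by simp
    qed (simp add: \<open>y d = 0\<close>)
    then have "y i = 0" for i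
      using y(1) \<open>\<And>i. i \<le> d \<Longrightarrow> y (d - i) = 0\<close>[of "d - i"] by (cases "i \<le> d") (auto simp: Ocar_def)
    then have "y = (\<lambda>x. 0)" by auto
    then have "basis_vec 0 = (\<lambda>x. 0)" using y(2) flin by simp
    then show False by (metis basis_vec_def zero_neq_one)
  qed
  obtain u i where "u \<in> U" "u i \<noteq> 0" using U(3) sub(1) by fast
  from O_contains_top_vector[OF U(1,2) invX this] obtain w0 where w0: "w0 \<in> U" "w0 d \<noteq> 0" by blast
  \<comment> \<open>Applying Y - theta*_j for j = d-1, ..., 0 removes everything but a nonzero multiple of y.\<close>
  have "i \<le> d \<Longrightarrow> \<exists>\<kappa> w. \<kappa> \<noteq> 0 \<and> w \<in> U \<and> (\<forall>x \<ge> d - i. w x = \<kappa> * y x)" for i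
  proof (induction i)
    case 0
    have "w0 x = w0 d / y d * y x" if "x \<ge> d" for x
      using that yd w0(1) U(2) y(1) by (cases "x = d") (auto simp: Ocar_def)
    moreover have "w0 d / y d \<noteq> 0" using w0(2) yd by simp
    ultimately show ?case using w0(1) by (metis minus_nat.diff_0)
  next
    case (Suc i)
    then obtain \<kappa> w where w: "\<kappa> \<noteq> 0" "w \<in> U" "\<And>x. x \<ge> d - i \<Longrightarrow> w x = \<kappa> * y x" by auto
    let ?j = "d - Suc i"
    let ?w = "\<lambda>x. OY d a b c w x - Otheta d b ?j * w x"
    have wc: "w \<in> Ocar d" using w(2) U(2) by blast
    have "?w \<in> U" using invY[OF w(2)] w(2) by (rule sub(4))
    moreover have "?w x = \<kappa> * (?\<theta> - Otheta d b ?j) * y x" if "x \<ge> ?j" for x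
    proof -
      have "w (Suc x) = \<kappa> * y (Suc x)" using w(3)[of "Suc x"] that by simp
      moreover have "x = ?j \<or> x \<ge> d - i" using that by arith
      then have "x = ?j \<or> w x = \<kappa> * y x" using w(3)[of x] by blast
      moreover have "Ophi d a b c (Suc x) * y (Suc x) = (?\<theta> - Otheta d b x) * y x"
        using fun_cong[OF Yy, of x] by (simp add: OY_row[OF y(1)] algebra_simps)
      then have "\<kappa> * (Ophi d a b c (Suc x) * y (Suc x)) = \<kappa> * ((?\<theta> - Otheta d b x) * y x)" by simp
      ultimately show ?thesis
        unfolding OY_row[OF wc] by (auto simp: algebra_simps)
    qed
    moreover have "\<kappa> * (?\<theta> - Otheta d b ?j) \<noteq> 0" using w(1) dist[of ?j] Suc(2) by auto
    ultimately show ?case by blast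
  qed
  from this[of d] obtain \<kappa> w where w: "\<kappa> \<noteq> 0" "w \<in> U" "\<And>x. w x = \<kappa> * y x" by auto
  have yU: "y \<in> U"
    using sub(3)[OF w(2), of "1 / \<kappa>"] w(1) by (simp add: w(3))
  \<comment> \<open>Cyclicity is transported by \<open>f\<close>, which commutes with X and maps y
    to the first basis vector.\<close>
  have fU: "i \<le> d \<Longrightarrow> basis_vec i \<in> f ` U" for i
  proof (induction i)
    case 0
    then show ?case using yU y(2) by force
  next
    case (Suc i)
    then obtain z where z: "z \<in> U" "f z = basis_vec i" by fastforce
    have "basis_vec (Suc i) = f (\<lambda>x. OX d a z x - Otheta d a i * z x)"
      using basis_vec_Suc[of i d a] Suc(2) f(3)[of z] z U(2) by (auto simp: flin)
    moreover have "(\<lambda>x. OX d a z x - Otheta d a i * z x) \<in> U"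
      using invX[OF z(1)] z(1) by (rule sub(4))
    ultimately show ?case by blast
  qed
  have "v \<in> U" if v: "v \<in> Ocar d" for v
  proof -
    have "\<forall>j\<in>{..d}. \<exists>z\<in>U. f z = basis_vec j" using fU by force
    then obtain z where z: "\<And>j. j \<le> d \<Longrightarrow> z j \<in> U \<and> f (z j) = basis_vec j"
      unfolding atMost_iff Ball_def bchoice_iff by (metis atMost_iff)
    define r where "r = (\<lambda>x. \<Sum>j\<le>d. f v j * z j x)"
    have r: "r \<in> U" unfolding r_def using z by (intro csubspace_of_sum[OF U(1)]) auto
    have fv: "f v \<in> Ocar d" using f(2) v by (auto simp: bij_betw_def)
    have "f r = (\<lambda>x. \<Sum>j\<le>d. f v j * basis_vec j x)"
      using z by (simp add: r_def clinear_UNIV_sum[OF f(1)])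
    then have "f r = f v" using Ocar_expand[OF fv] by simp
    then show ?thesis using f(2) r U(2) v by (auto simp: bij_betw_def dest: inj_onD)
  qed
  then show ?thesis using U(2) by blast
qed

section \<open>From the elementary isomorphisms to the twisted modules\<close>

lemma Ophi_nz_reverse:
  assumes "even d" "Ophi_nz d a b c"
  shows "Ophi_nz d (- b) (- a) c"
  unfolding Ophi_nz_def
proof (intro allI impI)
  fix i assume i: "1 \<le> i" "i \<le> d"
  then have "Ophi d a b c (d - (i - 1)) \<noteq> 0" by (intro Ophi_nzD[OF assms(2)]) auto
  then show "Ophi d (- b) (- a) c i \<noteq> 0"
    using Ophi_reverse[OF assms(1), of "i - 1" b a c] i by simp
qed

lemma bi_iso_siso:
  assumes "siso d {(s1, A1, act' 1), (s2, A2, act' 2), (s3, A3, act' 3)}"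
    and s: "s1 * s1 = 1" "s2 * s2 = 1" "s3 * s3 = 1"
    and act: "act 1 = (\<lambda>v x. s1 * A1 v x)" "act 2 = (\<lambda>v x. s2 * A2 v x)" "act 3 = (\<lambda>v x. s3 * A3 v x)"
  shows "bi_iso (Ocar d) act (Ocar d) act'"
proof -
  obtain f where f: "clinear_on UNIV f" "bij_betw f (Ocar d) (Ocar d)"
    and fS: "\<And>v. v \<in> Ocar d \<Longrightarrow> f (A1 v) = (\<lambda>x. s1 * act' 1 (f v) x)"
      "\<And>v. v \<in> Ocar d \<Longrightarrow> f (A2 v) = (\<lambda>x. s2 * act' 2 (f v) x)"
      "\<And>v. v \<in> Ocar d \<Longrightarrow> f (A3 v) = (\<lambda>x. s3 * act' 3 (f v) x)"
    using assms(1) unfolding siso_def by auto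
  have "f (act g v) = act' g (f v)" if g: "g \<in> {1, 2, 3}" and v: "v \<in> Ocar d" for g v
  proof -
    have "g = 1 \<or> g = 2 \<or> g = 3" using g by simp
    then show ?thesis
      by (elim disjE) (simp_all only: act clinear_UNIV_scale[OF f(1)] fS[OF v] mult.assoc[symmetric] s mult_1)
  qed
  moreover have "clinear_on (Ocar d) f" using f(1) by (simp add: clinear_on_def)
  ultimately show ?thesis using f(2) unfolding bi_iso_def by blast
qed

lemma bi_iso_perm23_Y:
  assumes "even d" "Ophi_nz d a b c" "Ophi_nz d a (- c) (- b)"
  shows "bi_iso (Ocar d) (twist (1, - 1) perm23 (Oact d a b c)) (Ocar d) (Oact d a (- c) (- b))"
proof (rule bi_iso_siso)
  let ?act = "Oact d a (- c) (- b)"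
  show "siso d {(1, OX d a, ?act 1), (-1, OZ d a b c, ?act 2), (-1, OY d a b c, ?act 3)}"
    by (rule siso_mono[OF siso_swap23[OF assms]]) (auto simp: Oact_def)
qed (simp_all add: fun_eq_iff twist_def perm23_def sgnaut_def Oact_def)

text \<open>The 3-cycle is obtained by exchanging X with Y and then Y with Z; the parameters pass
  through (-b,-a,c).\<close>

lemma bi_iso_perm123:
  assumes "even d" "Ophi_nz d a b c" "Ophi_nz d (- b) (- c) a"
  shows "bi_iso (Ocar d) (twist (1, - 1) perm123 (Oact d a b c)) (Ocar d) (Oact d (- b) (- c) a)"
proof (rule bi_iso_siso)
  let ?act = "Oact d (- b) (- c) a"
  have 0: "Ophi_nz d (- b) (- c) (- (- a))" using assms(3) by simp
  have 1: "siso d {(-1, OY d (- b) (- a) c, OZ d (- b) (- c) a), (1, OX d (- b), OX d (- b)),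
      (-1, OZ d (- b) (- a) c, OY d (- b) (- c) a)}"
    by (rule siso_mono[OF siso_swap23[OF assms(1) Ophi_nz_reverse[OF assms(1,2)] 0]]) auto
  show "siso d {(-1, OY d a b c, ?act 1), (-1, OZ d a b c, ?act 2), (1, OX d a, ?act 3)}"
    by (rule siso_mono[OF siso_trans3[OF siso_swap12[OF assms(1,2)] 1 O_ops_car]]) (auto simp: Oact_def)
qed (simp_all add: fun_eq_iff twist_def perm123_def sgnaut_def Oact_def)

text \<open>Exchange of Y and Z followed by the sign isomorphism; the parameters pass through
  (a,-c,-b).\<close>

lemma bi_iso_perm23_X:
  assumes "even d" "Ophi_nz d a b c" "Ophi_nz d a (- c) (- b)"
  shows "bi_iso (Ocar d) (twist (- 1, 1) perm23 (Oact d a b c)) (Ocar d) (Oact d (- a) (- c) b)"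
proof (rule bi_iso_siso)
  let ?act = "Oact d (- a) (- c) b"
  have 1: "siso d {(-1, OX d a, OX d (- a)), (-1, OZ d a (- c) (- b), OZ d (- a) (- c) b),
      (1, OY d a (- c) (- b), OY d (- a) (- c) b)}"
    by (rule siso_mono[OF siso_sign[OF assms(1), of a "- c" "- b"]]) auto
  show "siso d {(-1, OX d a, ?act 1), (-1, OZ d a b c, ?act 2), (1, OY d a b c, ?act 3)}"
    by (rule siso_mono[OF siso_trans3[OF siso_swap23[OF assms] 1 O_ops_car]]) (auto simp: Oact_def)
qed (simp_all add: fun_eq_iff twist_def perm23_def sgnaut_def Oact_def)

lemma bi_irreducible_twist:
  assumes "even d" "Ophi_nz d a b c" "Ophi_nz d b (- a) (- c)"
    and dist: "\<And>j. j < d \<Longrightarrow> Otheta d b j \<noteq> Otheta d b d"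
    and s: "s \<in> {(1, - 1), (- 1, 1)}" and \<sigma>: "\<sigma> \<in> {perm23, perm123}"
  shows "bi_irreducible (Ocar d) (twist s \<sigma> (Oact d a b c))"
  unfolding bi_irreducible_def
proof (intro conjI allI impI)
  have "basis_vec 0 \<in> Ocar d" "basis_vec 0 0 \<noteq> 0" by (simp_all add: basis_vec_car) (simp add: basis_vec_def)
  then show "Ocar d \<noteq> {\<lambda>_. 0}" by auto
  fix U assume U: "U \<subseteq> Ocar d"
    and inv: "csubspace_of U \<and> (\<forall>g\<in>{1, 2, 3}. \<forall>u\<in>U. twist s \<sigma> (Oact d a b c) g u \<in> U)"
  note sub = csubspace_of_D[OF conjunct1[OF inv]]
  have *: "Oact d a b c h u \<in> U" if u: "u \<in> U" and h: "h \<in> {1, 2}" for h u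
  proof -
    have "\<exists>g\<in>{1, 2, 3}. \<sigma> g = h" using \<sigma> h by (auto simp: perm23_def perm123_def)
    then obtain g where g: "g \<in> {1, 2, 3}" "\<sigma> g = h" by blast
    have "sgnaut s h * sgnaut s h = 1" using s h by (auto simp: sgnaut_def)
    moreover have "(\<lambda>x. sgnaut s h * twist s \<sigma> (Oact d a b c) g u x) \<in> U"
      using inv g u by (intro sub) blast
    ultimately show ?thesis by (simp add: twist_def g flip: mult.assoc)
  qed
  show "U = {\<lambda>_. 0} \<or> U = Ocar d"
  proof (cases "U = {\<lambda>_. 0}")
    case False
    have "U = Ocar d"
      by (rule O_irreducible[OF assms(1-3) dist conjunct1[OF inv] U False])
        (use *[of _ 1] *[of _ 2] in \<open>simp_all add: Oact_def\<close>)
    then show ?thesis ..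
  qed simp
qed

text \<open>For even i from 2 to d the second factor of phi_i vanishes iff 2(a+b+c) = d+1-2i, for
  odd i from 1 to d-1 iff 2(c-a-b) = 2i-d-1. In both cases the critical values lie between 1-d and
  d-3.\<close>

lemma Ophi_nz_of_real:
  fixes a b c :: real
  assumes "even d" and "2 * (a + b + c) < 1 - real d \<or> 2 * (a + b + c) > real d - 3"
    and "2 * (c - a - b) < 1 - real d \<or> 2 * (c - a - b) > real d - 3"
  shows "Ophi_nz d (of_real a) (of_real b) (of_real c)"
  unfolding Ophi_nz_def
proof (intro allI impI)
  fix i assume i: "1 \<le> i" "i \<le> d"
  show "Ophi d (of_real a) (of_real b) (of_real c) i \<noteq> 0"
  proof (cases "even i")
    case True
    then have "i \<ge> 2" using i(1) by presburger
    then have "real i * (real d + 1 - 2 * real i - 2 * a - 2 * b - 2 * c) \<noteq> 0"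
      using i assms(2) by auto
    moreover have "Ophi d (of_real a) (of_real b) (of_real c) i
      = of_real (real i * (real d + 1 - 2 * real i - 2 * a - 2 * b - 2 * c) / 2)"
      using True by (simp add: Ophi_def)
    ultimately show ?thesis by (auto simp only: of_real_eq_0_iff divide_eq_0_iff)
  next
    case False
    then have "d \<noteq> i" using assms(1) by auto
    then have "i + 1 \<le> d" using i(2) by simp
    then have "(real i - real d - 1) * (real d + 1 - 2 * real i - 2 * a - 2 * b + 2 * c) \<noteq> 0"
      using i assms(3) by auto
    moreover have "Ophi d (of_real a) (of_real b) (of_real c) i
      = of_real ((real i - real d - 1) * (real d + 1 - 2 * real i - 2 * a - 2 * b + 2 * c) / 2)"
      using False by (simp add: Ophi_def)
    ultimately show ?thesis by (auto simp only: of_real_eq_0_iff divide_eq_0_iff)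
  qed
qed

text \<open>The last eigenvalue is negative. For odd j the eigenvalue is positive, and for even j it
  increases strictly with j.\<close>

lemma Otheta_of_real_neq:
  fixes b :: real
  assumes "2 * b < - real d" "j < d" "even d"
  shows "Otheta d (of_real b) j \<noteq> Otheta d (of_real b) d"
proof -
  have "(-1) ^ j * (2 * b - real d + 2 * real j) / 2 \<noteq> (2 * b + real d) / 2"
    using assms by (cases "even j") auto
  moreover have "Otheta d (of_real b) j = of_real ((-1) ^ j * (2 * b - real d + 2 * real j) / 2)"
    "Otheta d (of_real b) d = of_real ((2 * b + real d) / 2)"
    using assms(3) by (simp_all add: Otheta_def)
  ultimately show ?thesis by (simp only: of_real_eq_iff not_False_eq_True)
qed

section \<open>Restriction to the plane x_2 = 0\<close>

text \<open>T_i maps x_i^m to this multiple of x_i^(m-1). Apart from m = 0 it vanishes exactly at m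
  = t_i, which is what splits the exponent axis.\<close>

definition dcoef :: "(nat \<Rightarrow> real) \<Rightarrow> nat \<Rightarrow> nat \<Rightarrow> complex" where
  "dcoef k i m = of_nat m + of_real (k i) * (1 - (-1) ^ m)"

lemma dcoef_0 [simp]: "dcoef k i 0 = 0"
  by (simp add: dcoef_def)

lemma dunkl_eq: "dunkl k i F (j, \<alpha>) = dcoef k i (expo i \<alpha> + 1) * F (j, incr i \<alpha>)"
  by (cases \<alpha>) (auto simp: dunkl_def partial_def divx_def refl_def dcoef_def algebra_simps)

lemma Dirac_eq:
  "Dirac k F (0, (a, b, c)) = dcoef k 1 (a + 1) * F (1, (a + 1, b, c))
     - \<i> * (dcoef k 2 (b + 1) * F (1, (a, b + 1, c))) + dcoef k 3 (c + 1) * F (0, (a, b, c + 1))"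
  "Dirac k F (1, (a, b, c)) = dcoef k 1 (a + 1) * F (0, (a + 1, b, c))
     + \<i> * (dcoef k 2 (b + 1) * F (0, (a, b + 1, c))) - dcoef k 3 (c + 1) * F (1, (a, b, c + 1))"
  "j \<ge> 2 \<Longrightarrow> Dirac k F (j, \<alpha>) = 0"
  by (simp_all add: Dirac_def sig_def dunkl_eq)

lemma Dirac_linear: "Dirac k (\<lambda>x. e * u x + w x) = (\<lambda>y. e * Dirac k u y + Dirac k w y)"
proof
  fix y :: "nat \<times> mono"
  obtain j a b c where y: "y = (j, (a, b, c))" by (metis prod.exhaust)
  consider "j = 0" | "j = 1" | "j \<ge> 2" by linarith
  then show "Dirac k (\<lambda>x. e * u x + w x) y = e * Dirac k u y + Dirac k w y"
    by cases (simp_all only: y Dirac_eq, simp_all add: algebra_simps)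
qed

lemma Mn_linear: "u \<in> Mn k n \<Longrightarrow> w \<in> Mn k n \<Longrightarrow> (\<lambda>x. e * u x + w x) \<in> Mn k n"
  by (auto simp: Mn_def Dirac_linear PolySpace_def)
    (metis add.right_neutral mult_zero_right)+

lemma Mn_Dirac: "F \<in> Mn k n \<Longrightarrow> Dirac k F m = 0"
  by (simp add: Mn_def)

text \<open>The Boolean selects an eigenspace of e_3 R_3, in which the parity of the x_3-exponent determines the
  C^2-component. The sign makes the second copy satisfy the same formulas as the first.\<close>

definition bdry :: "nat \<Rightarrow> bool \<Rightarrow> pvec \<Rightarrow> nat \<Rightarrow> complex" where
  "bdry n s F a = (if s then (-1) ^ a else 1) * F (if even a = s then 1 else 0, (a, 0, n - a))"

lemma bdry_linear: "bdry n s (\<lambda>x. e * u x + w x) a = e * bdry n s u a + bdry n s w a"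
  by (simp add: bdry_def algebra_simps)

lemma bdry_above: "F \<in> Mn k n \<Longrightarrow> a > n \<Longrightarrow> bdry n s F a = 0"
  by (force simp: bdry_def Mn_def PolySpace_def)

lemma bdry_0:
  assumes F: "F \<in> Mn k n" and 0: "\<And>s. bdry n s F a = 0"
  shows "F (j, (a, 0, c)) = 0"
proof (rule ccontr)
  assume *: "F (j, (a, 0, c)) \<noteq> 0"
  then have "j < 2" "c = n - a" using F by (force simp: Mn_def PolySpace_def)+
  then show False
    using 0[of True] 0[of False] * by (cases "even a"; cases "j = 0") (auto simp: bdry_def less_2_cases_iff)
qed

text \<open>On the plane the summand of X with the factor x_2 disappears, and only x_3 T_2 has to be
  rewritten. \<open>actM_3_bdry\<close> is the mirror image with x_1 T_2.\<close>

lemma actM_1_bdry: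
  assumes F: "F \<in> Mn k n" and "even n" "a \<le> n"
  shows "bdry n s (actM k 1 F) a = (-1) ^ a * (of_nat (n - a) + 1 / 2 + of_real (k 2) + of_real (k 3)) * bdry n s F a
    + dcoef k 1 (a + 1) * bdry n s F (a + 1)"
proof -
  obtain c where c: "n = a + c" using assms(3) le_Suc_ex by blast
  have par: "even c = even a" using assms(2) c by auto
  show ?thesis
  proof (cases c)
    case 0
    have "bdry n s F (a + 1) = 0" using bdry_above[OF F] c 0 by simp
    then show ?thesis
      using par 0 c by (auto simp: bdry_def actM_def biop_def Let_def mulx_def sig_def refl_def algebra_simps)
  next
    case (Suc l)
    \<comment> \<open>The Dirac equation at x_1^a x_3^l, solved for the coefficients that are linear
      in x_2.\<close>
    have D: "\<i> * (dcoef k 2 1 * F (1, (a, 1, l))) = dcoef k 1 (a + 1) * F (1, (a + 1, 0, l)) + dcoef k 3 c * F (0, (a, 0, c))"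
      "\<i> * (dcoef k 2 1 * F (0, (a, 1, l))) = - dcoef k 1 (a + 1) * F (0, (a + 1, 0, l)) + dcoef k 3 c * F (1, (a, 0, c))"
      using Mn_Dirac[OF F, of "(0, (a, 0, l))"] Mn_Dirac[OF F, of "(1, (a, 0, l))"]
      unfolding Dirac_eq Suc by (simp_all add: add_eq_0_iff algebra_simps)
    have E: "dcoef k 3 c = (if even a then of_nat c else of_nat c + 2 * of_real (k 3))"
      using par by (simp add: dcoef_def)
    have X: "actM k 1 F (j, (a, 0, c)) = \<i> * sig 1 (\<lambda>m. mulx 3 (dunkl k 2 (refl 2 (refl 3 F))) m) (j, (a, 0, c))
      + (1 / 2 + of_real (k 2)) * ((-1) ^ a * F (j, (a, 0, c))) + of_real (k 3) * F (j, (a, 0, c))" for j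
      using par by (simp add: actM_def biop_def Let_def mulx_def sig_def refl_def minus_one_power_iff algebra_simps)
    have S: "\<i> * sig 1 (\<lambda>m. mulx 3 (dunkl k 2 (refl 2 (refl 3 F))) m) (0, (a, 0, c))
        = (-1) ^ a * (\<i> * (dcoef k 2 1 * F (1, (a, 1, l))))"
      "\<i> * sig 1 (\<lambda>m. mulx 3 (dunkl k 2 (refl 2 (refl 3 F))) m) (1, (a, 0, c))
        = (-1) ^ a * (\<i> * (dcoef k 2 1 * F (0, (a, 1, l))))"
      using par by (cases "even a"; auto simp: sig_def mulx_def dunkl_eq refl_def Suc minus_one_power_iff)+
    show ?thesis
      using c Suc unfolding bdry_def
      by (cases s; cases "even a"; simp add: X[unfolded One_nat_def Suc] S[unfolded One_nat_def Suc] D[unfolded One_nat_def Suc] E[unfolded One_nat_def Suc]; simp add: algebra_simps)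
  qed
qed

lemma actM_3_bdry:
  assumes F: "F \<in> Mn k n" and "even n" "a \<le> n"
  shows "bdry n s (actM k 3 F) a = (-1) ^ a * (of_nat a + 1 / 2 + of_real (k 1) + of_real (k 2)) * bdry n s F a
    - (if a = 0 then 0 else dcoef k 3 (n - a + 1) * bdry n s F (a - 1))"
proof -
  obtain c where c: "n = a + c" using assms(3) le_Suc_ex by blast
  have par: "even c = even a" using assms(2) c by auto
  show ?thesis
  proof (cases a)
    case 0
    then show ?thesis
      using par c by (auto simp: bdry_def actM_def biop_def Let_def mulx_def sig_def refl_def algebra_simps)
  next
    case (Suc l)
    have D: "\<i> * (dcoef k 2 1 * F (1, (l, 1, c))) = dcoef k 1 a * F (1, (a, 0, c)) + dcoef k 3 (c + 1) * F (0, (l, 0, c + 1))"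
      "\<i> * (dcoef k 2 1 * F (0, (l, 1, c))) = - dcoef k 1 a * F (0, (a, 0, c)) + dcoef k 3 (c + 1) * F (1, (l, 0, c + 1))"
      using Mn_Dirac[OF F, of "(0, (l, 0, c))"] Mn_Dirac[OF F, of "(1, (l, 0, c))"]
      unfolding Dirac_eq Suc by (simp_all add: add_eq_0_iff algebra_simps)
    have E: "dcoef k 1 a = (if even a then of_nat a else of_nat a + 2 * of_real (k 1))"
      by (simp add: dcoef_def)
    have X: "actM k 3 F (j, (a, 0, c)) = - \<i> * sig 3 (\<lambda>m. mulx 1 (dunkl k 2 (refl 1 (refl 2 F))) m) (j, (a, 0, c))
      + (1 / 2 + of_real (k 2)) * ((-1) ^ a * F (j, (a, 0, c))) + of_real (k 1) * F (j, (a, 0, c))" for j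
      using par by (simp add: actM_def biop_def Let_def mulx_def sig_def refl_def minus_one_power_iff algebra_simps)
    have S: "\<i> * sig 3 (\<lambda>m. mulx 1 (dunkl k 2 (refl 1 (refl 2 F))) m) (0, (a, 0, c))
        = (-1) ^ a * (\<i> * (dcoef k 2 1 * F (0, (l, 1, c))))"
      "\<i> * sig 3 (\<lambda>m. mulx 1 (dunkl k 2 (refl 1 (refl 2 F))) m) (1, (a, 0, c))
        = - ((-1) ^ a * (\<i> * (dcoef k 2 1 * F (1, (l, 1, c)))))"
      using par by (cases "even a"; auto simp: sig_def mulx_def dunkl_eq refl_def Suc minus_one_power_iff)+
    have c': "n - (a - 1) = c + 1" "n - a = c" using c Suc by simp_all
    show ?thesis
      unfolding bdry_def c' using Suc
      by (cases s; cases "even l"; simp add: X[unfolded One_nat_def Suc] S[unfolded One_nat_def Suc] D[unfolded One_nat_def Suc] E[unfolded One_nat_def Suc]; simp add: algebra_simps)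
  qed
qed

text \<open>Y is tangential to the plane x_2 = 0: it contains only x_1, x_3 and their Dunkl
  operators, so its restriction is computed directly and has neighbours on both sides.\<close>

lemma actM_2_bdry:
  assumes F: "F \<in> Mn k n" and "even n" "a \<le> n"
  shows "bdry n s (actM k 2 F) a = (-1) ^ a * ((if a = 0 then 0 else dcoef k 3 (n - a + 1) * bdry n s F (a - 1))
      - dcoef k 1 (a + 1) * bdry n s F (a + 1))
    + (1 / 2 + (-1) ^ a * (of_real (k 1) + of_real (k 3))) * bdry n s F a"
proof -
  obtain c where c: "n = a + c" using assms(3) le_Suc_ex by blast
  have par: "even c = even a" using assms(2) c by auto
  have "F (j, (a + 1, 0, 0)) = 0" if "c = 0" for j using F c that by (force simp: Mn_def PolySpace_def)
  then show ?thesis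
    using par c unfolding bdry_def
    by (cases a; cases c; cases s; cases "even a")
      (auto simp: actM_def biop_def Let_def mulx_def sig_def refl_def dunkl_eq algebra_simps)
qed

section \<open>Cauchy-Kovalevskaya extension\<close>

lemma tpar_enat:
  assumes "tpar \<kappa> = enat t"
  shows "odd t" "2 * \<kappa> = - real t"
proof -
  from assms obtain m :: int where m: "odd m" "m < 0" "2 * \<kappa> = real_of_int m"
    and "enat (nat \<lfloor>- 2 * \<kappa>\<rfloor>) = enat t"
    unfolding tpar_def by (auto split: if_splits)
  moreover have "- 2 * \<kappa> = real_of_int (- m)" using m(3) by simp
  ultimately have "t = nat (- m)" by (metis enat.inject floor_of_int)
  then show "odd t" "2 * \<kappa> = - real t" using m by (simp_all add: even_nat_iff)
qed

lemma dcoef_eq_0_iff: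
  "dcoef k i m = 0 \<longleftrightarrow> m = 0 \<or> odd m \<and> 2 * k i = - real m"
proof (cases "even m")
  case False
  have "dcoef k i m = of_real (real m + 2 * k i)" using False by (simp add: dcoef_def)
  then show ?thesis using False by (auto simp only: of_real_eq_0_iff)
qed (simp add: dcoef_def)

lemma dcoef_neq_0:
  assumes "1 \<le> m" "enat m < tpar (k i)"
  shows "dcoef k i m \<noteq> 0"
proof
  assume "dcoef k i m = 0"
  then have "odd m" "2 * k i = - real m" using assms(1) by (auto simp: dcoef_eq_0_iff)
  then have "\<exists>l::int. odd l \<and> l < 0 \<and> 2 * k i = real_of_int l"
    using assms(1) by (intro exI[of _ "- int m"]) auto
  moreover have "nat \<lfloor>- 2 * k i\<rfloor> = m" using \<open>2 * k i = - real m\<close> by simp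
  ultimately have "tpar (k i) = enat m" by (simp add: tpar_def)
  then show False using assms(2) by simp
qed

text \<open>The Dirac equation at x_1^a x_2^b x_3^c, solved for the coefficient with x_2-exponent
  b+1.\<close>

fun ck_coef :: "(nat \<Rightarrow> real) \<Rightarrow> (nat \<Rightarrow> nat \<Rightarrow> nat \<Rightarrow> complex) \<Rightarrow> nat \<Rightarrow> nat \<Rightarrow> nat \<Rightarrow> nat \<Rightarrow> complex" where
  "ck_coef k u 0 j a c = u j a c"
| "ck_coef k u (Suc b) j a c = (if j = 0
     then \<i> * (dcoef k 1 (a + 1) * ck_coef k u b 0 (a + 1) c - dcoef k 3 (c + 1) * ck_coef k u b 1 a (c + 1)) / dcoef k 2 (b + 1)
     else - \<i> * (dcoef k 1 (a + 1) * ck_coef k u b 1 (a + 1) c + dcoef k 3 (c + 1) * ck_coef k u b 0 a (c + 1)) / dcoef k 2 (b + 1))"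

lemma ck_coef_degree:
  assumes "\<And>j a c. a + c \<noteq> n \<Longrightarrow> u j a c = 0"
  shows "a + b + c \<noteq> n \<Longrightarrow> ck_coef k u b j a c = 0"
  by (induction b arbitrary: j a c) (simp_all add: assms)

lemma CK_extension:
  assumes "enat n < tpar (k 2)" and u: "\<And>j a c. a + c \<noteq> n \<Longrightarrow> u j a c = 0"
  shows "\<exists>F \<in> Mn k n. \<forall>j<2. \<forall>a c. F (j, (a, 0, c)) = u j a c"
proof -
  define F :: pvec where "F = (\<lambda>(j, (a, b, c)). if j < 2 then ck_coef k u b j a c else 0)"
  have F: "F (j, (a, b, c)) = (if j < 2 then ck_coef k u b j a c else 0)" for j a b c
    by (simp add: F_def)
  have Fn: "F (j, (a, b, c)) = 0" if "a + b + c \<noteq> n" for j a b c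
    using ck_coef_degree[OF u] that by (simp add: F)
  have "F \<in> PolySpace n"
    unfolding PolySpace_def
  proof (intro CollectI allI impI)
    fix j \<alpha> assume nz: "F (j, \<alpha>) \<noteq> 0"
    obtain a b c where \<alpha>: "\<alpha> = (a, b, c)" by (metis prod.exhaust)
    show "j < 2 \<and> deg \<alpha> = n"
      using nz Fn[of a b c j] by (cases "j < 2") (auto simp: \<alpha> F)
  qed
  moreover have "Dirac k F m = 0" for m
  proof -
    obtain j a b c where m: "m = (j, (a, b, c))" by (metis prod.exhaust)
    show ?thesis
    proof (cases "a + b + c + 1 = n")
      \<comment> \<open>Outside degree n-1 all coefficients in the equation have the wrong total
        degree and are zero.\<close>
      case False
      consider "j = 0" | "j = 1" | "j \<ge> 2" by linarith
      then show ?thesis using False by cases (simp_all only: m Dirac_eq, simp_all add: Fn)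
    next
      case True
      have "enat (b + 1) \<le> enat n" using True by simp
      from le_less_trans[OF this assms(1)] have d: "dcoef k 2 (b + 1) \<noteq> 0"
        by (intro dcoef_neq_0) auto
      have ii: "x * \<i> * \<i> = - x" "\<i> * (\<i> * x) = - x" for x by (simp_all flip: mult.assoc) (simp add: mult.assoc)
      consider "j = 0" | "j = 1" | "j \<ge> 2" by linarith
      then show ?thesis
        by cases (simp_all only: m Dirac_eq, use d ii in \<open>simp_all add: F field_simps\<close>)
    qed
  qed
  ultimately have "F \<in> Mn k n" by (auto simp: Mn_def)
  then show ?thesis by (intro bexI[of _ F]) (simp_all add: F)
qed

lemma Mn_exists_bdry:
  assumes "enat n < tpar (k 2)"
  shows "\<exists>F \<in> Mn k n. \<forall>s. \<forall>a\<le>n. bdry n s F a = h s a"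
proof -
  \<comment> \<open>This inverts \<open>bdry\<close>: each C^2-component belongs to exactly one
    Boolean, depending on the parity of a, and the sign of the second copy is undone.\<close>
  define u where "u j a c = (if a + c = n then if even a \<longleftrightarrow> j = 0 then h False a else (-1) ^ a * h True a else 0)"
    for j :: nat and a c :: nat
  obtain F where F: "F \<in> Mn k n" "\<forall>j<2. \<forall>a c. F (j, (a, 0, c)) = u j a c"
    using CK_extension[of n k u] assms by (auto simp: u_def)
  have "bdry n s F a = h s a" if "a \<le> n" for s a
    using F(2) that by (cases s; cases "even a") (simp_all add: bdry_def u_def)
  then show ?thesis using F(1) by blast
qed

text \<open>Z is a set of exponents (a, c) that the recursion in x_2 cannot leave.\<close>

lemma Mn_vanish:
  assumes "enat n < tpar (k 2)" and F: "F \<in> Mn k n"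
    and Z1: "\<And>a c. Z a c \<Longrightarrow> dcoef k 1 (a + 1) = 0 \<or> Z (a + 1) c"
    and Z3: "\<And>a c. Z a c \<Longrightarrow> dcoef k 3 (c + 1) = 0 \<or> Z a (c + 1)"
    and F0: "\<And>j a c. Z a c \<Longrightarrow> F (j, (a, 0, c)) = 0"
  shows "Z a c \<Longrightarrow> F (j, (a, b, c)) = 0"
proof (induction b arbitrary: j a c)
  case (Suc b)
  show ?case
  proof (rule ccontr)
    assume nz: "F (j, (a, Suc b, c)) \<noteq> 0"
    then have j: "j < 2" "a + Suc b + c = n" using F by (force simp: Mn_def PolySpace_def)+
    have "enat (b + 1) \<le> enat n" using j(2) by simp
    from le_less_trans[OF this assms(1)] have d: "dcoef k 2 (b + 1) \<noteq> 0"
      by (intro dcoef_neq_0) auto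
    have "dcoef k 1 (a + 1) * F (i, (a + 1, b, c)) = 0" "dcoef k 3 (c + 1) * F (i, (a, b, c + 1)) = 0" for i
      using Z1[OF Suc(2)] Z3[OF Suc(2)] Suc(1) by auto
    then have "dcoef k 2 (b + 1) * F (j, (a, b + 1, c)) = 0"
      using Mn_Dirac[OF F, of "(0, (a, b, c))"] Mn_Dirac[OF F, of "(1, (a, b, c))"] j(1)
      unfolding Dirac_eq less_2_cases_iff by fastforce
    then show False using d nz by simp
  qed
qed (rule F0)

lemma Mn_bdry_eq_0:
  assumes "enat n < tpar (k 2)" and F: "F \<in> Mn k n" and 0: "\<And>s a. a \<le> n \<Longrightarrow> bdry n s F a = 0"
  shows "F = (\<lambda>_. 0)"
proof
  fix m
  have b: "bdry n s F a = 0" for s a using 0 bdry_above[OF F] by (meson not_le)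
  show "F m = 0"
    using Mn_vanish[OF assms(1) F, of "\<lambda>_ _. True"] bdry_0[OF F b] by (cases m) (auto simp: split_paired_all)
qed

text \<open>The recursion refers from a to a+1 and could leave the region a < t only at a = t-1,
  where its factor \<open>dcoef k 1 t\<close> is zero. Vanishing on the plane therefore spreads to
  all powers of x_2.\<close>

lemma Mnx_1_iff:
  assumes "enat n < tpar (k 2)" "tpar (k 1) = enat t"
  shows "Mnx k n 1 = {F \<in> Mn k n. \<forall>s a. a < t \<longrightarrow> bdry n s F a = 0}"
proof (intro set_eqI iffI)
  fix F assume F: "F \<in> Mnx k n 1"
  have "bdry n s F a = 0" if "a < t" for s a
    using F that assms(2) by (force simp: bdry_def Mnx_def)
  then show "F \<in> {F \<in> Mn k n. \<forall>s a. a < t \<longrightarrow> bdry n s F a = 0}" using F by (simp add: Mnx_def)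
next
  fix F assume "F \<in> {F \<in> Mn k n. \<forall>s a. a < t \<longrightarrow> bdry n s F a = 0}"
  then have F: "F \<in> Mn k n" and 0: "\<And>s a. a < t \<Longrightarrow> bdry n s F a = 0" by auto
  have "dcoef k 1 t = 0" using tpar_enat[OF assms(2)] by (simp add: dcoef_eq_0_iff)
  then have Z: "a < t \<Longrightarrow> dcoef k 1 (a + 1) = 0 \<or> a + 1 < t" for a
    by (cases "a + 1 = t") auto
  have "F (j, (a, b, c)) = 0" if "a < t" for j a b c
    by (rule Mn_vanish[OF assms(1) F, of "\<lambda>a c. a < t"]) (use that Z 0 in \<open>auto intro: bdry_0[OF F]\<close>)
  then show "F \<in> Mnx k n 1" using F assms(2) by (auto simp: Mnx_def not_le[symmetric])
qed

text \<open>The same closure argument in the x_3-exponent. For a > n the truncated difference n - a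
  is 0, and the condition holds there because of the degree.\<close>

lemma Mnx_3_iff:
  assumes "enat n < tpar (k 2)" "tpar (k 3) = enat t"
  shows "Mnx k n 3 = {F \<in> Mn k n. \<forall>s a. n - a < t \<longrightarrow> bdry n s F a = 0}"
proof (intro set_eqI iffI)
  fix F assume F: "F \<in> Mnx k n 3"
  have "bdry n s F a = 0" if "n - a < t" for s a
    using F that assms(2) by (force simp: bdry_def Mnx_def)
  then show "F \<in> {F \<in> Mn k n. \<forall>s a. n - a < t \<longrightarrow> bdry n s F a = 0}" using F by (simp add: Mnx_def)
next
  fix F assume "F \<in> {F \<in> Mn k n. \<forall>s a. n - a < t \<longrightarrow> bdry n s F a = 0}"
  then have F: "F \<in> Mn k n" and 0: "\<And>s a. n - a < t \<Longrightarrow> bdry n s F a = 0" by auto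
  have "dcoef k 3 t = 0" using tpar_enat[OF assms(2)] by (simp add: dcoef_eq_0_iff)
  then have Z: "c < t \<Longrightarrow> dcoef k 3 (c + 1) = 0 \<or> c + 1 < t" for c
    by (cases "c + 1 = t") auto
  have F0: "F (j, (a, 0, c)) = 0" if "c < t" for j a c
  proof (rule ccontr)
    assume *: "F (j, (a, 0, c)) \<noteq> 0"
    then have "n - a = c" using F by (force simp: Mn_def PolySpace_def)
    then show False using bdry_0[OF F 0, of a j c] that * by simp
  qed
  have "F (j, (a, b, c)) = 0" if "c < t" for j a b c
    by (rule Mn_vanish[OF assms(1) F, of "\<lambda>a c. c < t"]) (use that Z F0 in auto)
  then show "F \<in> Mnx k n 3" using F assms(2) by (auto simp: Mnx_def not_le[symmetric])
qed

section \<open>Quotient maps given by coordinates on the plane\<close>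

definition block :: "nat \<Rightarrow> nat \<Rightarrow> (nat \<Rightarrow> nat) \<Rightarrow> (nat \<Rightarrow> complex) \<Rightarrow> pvec \<Rightarrow> bool \<times> nat \<Rightarrow> complex" where
  "block n d \<alpha> l F = (\<lambda>(s, i). if i \<le> d then l i * bdry n s F (\<alpha> i) else 0)"

text \<open>Values on the plane can be prescribed freely, hence reading off those at the exponents
  \<alpha>_i, which avoid Z, is onto even from V. The kernel is N by its very form.\<close>

lemma block_quot_iso:
  assumes n: "enat n < tpar (k 2)"
    and \<alpha>: "inj_on \<alpha> {..d}" "\<And>i. i \<le> d \<Longrightarrow> \<alpha> i \<le> n \<and> \<alpha> i \<notin> Z" and l: "\<And>i. i \<le> d \<Longrightarrow> l i \<noteq> 0"
    and V: "V = {F \<in> Mn k n. \<forall>s. \<forall>a\<in>Z. bdry n s F a = 0}"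
    and N: "N = {F \<in> V. \<forall>s. \<forall>i\<le>d. bdry n s F (\<alpha> i) = 0}"
    and act: "\<And>F s g. F \<in> V \<Longrightarrow> g \<in> {1, 2, 3} \<Longrightarrow>
      (\<lambda>i. block n d \<alpha> l (actM k g F) (s, i)) = act g (\<lambda>i. block n d \<alpha> l F (s, i))"
  shows "bi_quot_iso V N (actM k) (dsum_car (Ocar d)) (dsum_act act)"
  unfolding bi_quot_iso_def
proof (intro exI[of _ "block n d \<alpha> l"] conjI ballI)
  show "clinear_on V (block n d \<alpha> l)"
    unfolding clinear_on_def block_def bdry_linear by (auto simp: fun_eq_iff algebra_simps)
  show "block n d \<alpha> l ` V = dsum_car (Ocar d)"
  proof (intro equalityI subsetI)
    fix h assume h: "h \<in> dsum_car (Ocar d)"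
    \<comment> \<open>The preimage has the prescribed values on the block and zero elsewhere, in
      particular on Z.\<close>
    obtain F where F: "F \<in> Mn k n"
      "\<forall>s. \<forall>a\<le>n. bdry n s F a = (if a \<in> \<alpha> ` {..d} then h (s, the_inv_into {..d} \<alpha> a) / l (the_inv_into {..d} \<alpha> a) else 0)"
      using n Mn_exists_bdry[of n k "\<lambda>s a. if a \<in> \<alpha> ` {..d} then h (s, the_inv_into {..d} \<alpha> a) / l (the_inv_into {..d} \<alpha> a) else 0"]
      by blast
    have "bdry n s F a = 0" if "a \<in> Z" for s a
      using F that \<alpha>(2) bdry_above[OF F(1), of a s] by (cases "a \<le> n") auto
    then have "F \<in> V" using F(1) V by blast
    moreover have "block n d \<alpha> l F = h"
    proof
      fix x :: "bool \<times> nat"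
      obtain s i where x: "x = (s, i)" by fastforce
      have "h (s, i) = 0" if "i > d"
        using h that by (cases s) (auto simp: dsum_car_def Ocar_def)
      then show "block n d \<alpha> l F x = h x"
        using F(2) \<alpha> l[of i] by (auto simp: x block_def the_inv_into_f_f)
    qed
    ultimately show "h \<in> block n d \<alpha> l ` V" by blast
  qed (auto simp: block_def dsum_car_def Ocar_def)
  show "(block n d \<alpha> l F = (\<lambda>_. 0)) = (F \<in> N)" if "F \<in> V" for F
    using that l unfolding N by (auto simp: block_def fun_eq_iff)
  show "block n d \<alpha> l (actM k g F) = dsum_act act g (block n d \<alpha> l F)" if "g \<in> {1, 2, 3}" "F \<in> V" for g F
    unfolding dsum_act_def using fun_cong[OF act[OF that(2,1)]] by (auto simp: fun_eq_iff)
qed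

lemma bi_iso_quot_zero:
  assumes "bi_quot_iso V {\<lambda>_. 0} act W act'" and V: "\<And>u w. u \<in> V \<Longrightarrow> w \<in> V \<Longrightarrow> (\<lambda>x. - 1 * u x + w x) \<in> V"
  shows "bi_iso V act W act'"
proof -
  obtain f where f: "clinear_on V f" "f ` V = W" "\<forall>v\<in>V. (f v = (\<lambda>_. 0)) = (v \<in> {\<lambda>_. 0})"
    "\<forall>g\<in>{1, 2, 3}. \<forall>v\<in>V. f (act g v) = act' g (f v)"
    using assms(1) unfolding bi_quot_iso_def by blast
  have "inj_on f V"
  proof (rule inj_onI)
    fix u w assume u: "u \<in> V" "w \<in> V" "f u = f w"
    have "f (\<lambda>x. - 1 * u x + w x) = (\<lambda>y. - 1 * f u y + f w y)"
      using f(1) u(1,2) unfolding clinear_on_def by blast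
    then have "(\<lambda>x. - 1 * u x + w x) = (\<lambda>_. 0)" using f(3) V[OF u(1,2)] u(3) by simp
    then show "u = w" by (simp add: fun_eq_iff add_eq_0_iff)
  qed
  then show ?thesis using f unfolding bi_iso_def bij_betw_def by blast
qed

section \<open>Bidiagonal blocks\<close>

lemma block_car: "(\<lambda>i. block n d \<alpha> l F (s, i)) \<in> Ocar d"
  by (simp add: block_def Ocar_def)

lemma OZ_Suc_block:
  assumes "even d" "i \<le> d"
  shows "OZ d a b c (\<lambda>i. block n d \<alpha> l F (s, i)) i = Ozeta d c i * (l i * bdry n s F (\<alpha> i))
    + (-1) ^ i * ((if i = 0 then 0 else l (i - 1) * bdry n s F (\<alpha> (i - 1)))
      - (if i = d then 0 else Ophi d a b c (Suc i) * l (Suc i) * bdry n s F (\<alpha> (Suc i))))"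
proof (cases i)
  case 0
  then show ?thesis
    using assms by (auto simp: OZ_0[OF assms(1) block_car]) (auto simp: block_def)
next
  case (Suc j)
  then show ?thesis
    using assms by (auto simp: OZ_Suc[OF assms(1) block_car]) (auto simp: block_def algebra_simps)
qed

lemma OX_block:
  "i \<le> d \<Longrightarrow> OX d a (\<lambda>i. block n d \<alpha> l F (s, i)) i = Otheta d a i * (l i * bdry n s F (\<alpha> i))
    + (if i = 0 then 0 else l (i - 1) * bdry n s F (\<alpha> (i - 1)))"
  by (cases i) (simp_all add: OX_def block_def)

lemma OY_block:
  "i \<le> d \<Longrightarrow> OY d a b c (\<lambda>i. block n d \<alpha> l F (s, i)) i = Otheta d b i * (l i * bdry n s F (\<alpha> i))
    + (if i = d then 0 else Ophi d a b c (Suc i) * l (Suc i) * bdry n s F (\<alpha> (Suc i)))"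
  by (simp add: OY_def block_def)

text \<open>X couples a to a+1, so a must decrease with the index i for X to become lower
  bidiagonal. The recursion for \<open>l\<close> turns this coupling into \<open>\<epsilon>\<close>,
  the sign of (-1)^A; \<open>top\<close> and \<open>bot\<close> cut the couplings that leave the
  block.\<close>

lemma block_descending:
  assumes n: "even n" and d: "even d" "d \<le> A" "A \<le> n" and \<epsilon>: "\<epsilon> * \<epsilon> = 1" and F: "F \<in> Mn k n"
    and l: "\<And>i. i < d \<Longrightarrow> l (Suc i) = \<epsilon> * l i / dcoef k 1 (A - i)"
    and nz: "\<And>i. i < d \<Longrightarrow> dcoef k 1 (A - i) \<noteq> 0"
    and top: "bdry n s F (A + 1) = 0"
    and bot: "A \<noteq> d \<Longrightarrow> dcoef k 3 (n - (A - d) + 1) * bdry n s F (A - d - 1) = 0"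
    and th: "\<And>i. i \<le> d \<Longrightarrow> (-1) ^ (A - i) * (of_nat (n - (A - i)) + 1 / 2 + of_real (k 2) + of_real (k 3)) = \<epsilon> * Otheta d a i"
    and ths: "\<And>i. i \<le> d \<Longrightarrow> (-1) ^ (A - i) * (of_nat (A - i) + 1 / 2 + of_real (k 1) + of_real (k 2)) = - \<epsilon> * Otheta d b i"
    and ze: "\<And>i. i \<le> d \<Longrightarrow> 1 / 2 + (-1) ^ (A - i) * (of_real (k 1) + of_real (k 3)) = - Ozeta d c i"
    and sg: "\<And>i. i \<le> d \<Longrightarrow> (-1) ^ (A - i) = \<epsilon> * (-1) ^ i"
    and ph: "\<And>i. i < d \<Longrightarrow> Ophi d a b c (Suc i) = dcoef k 3 (n - (A - i) + 1) * dcoef k 1 (A - i)"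
    and act: "act 1 = (\<lambda>v x. \<epsilon> * OX d a v x)" "act 2 = (\<lambda>v x. - OZ d a b c v x)" "act 3 = (\<lambda>v x. - \<epsilon> * OY d a b c v x)"
    and g: "g \<in> {1, 2, 3}"
  shows "(\<lambda>i. block n d (\<lambda>i. A - i) l (actM k g F) (s, i)) = act g (\<lambda>i. block n d (\<lambda>i. A - i) l F (s, i))"
proof
  fix i
  let ?v = "\<lambda>i. block n d (\<lambda>i. A - i) l F (s, i)"
  have ee: "\<epsilon> * (\<epsilon> * z) = z" for z using \<epsilon> by (simp flip: mult.assoc)
  show "block n d (\<lambda>i. A - i) l (actM k g F) (s, i) = act g ?v i"
  proof (cases "i \<le> d")
    case False
    then have "act g ?v i = 0"
      using g act OX_car[of d a ?v] OY_car[of d a b c ?v] OZ_car[OF block_car[of n d "\<lambda>i. A - i" l F s], of a b c]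
      by (auto simp: Ocar_def)
    then show ?thesis using False by (simp add: block_def)
  next
    case True
    have A: "A - i \<le> n" using d by simp
    have up: "l i * (dcoef k 1 (A - i + 1) * bdry n s F (A - i + 1))
      = \<epsilon> * (if i = 0 then 0 else l (i - 1) * bdry n s F (A - (i - 1)))"
    proof (cases i)
      case (Suc j)
      then have "A - i + 1 = A - j" using True d by simp
      then show ?thesis using Suc True l[of j] nz[of j] by simp
    qed (use top in simp)
    have dn: "l i * (if A - i = 0 then 0 else dcoef k 3 (n - (A - i) + 1) * bdry n s F (A - i - 1))
      = \<epsilon> * (if i = d then 0 else Ophi d a b c (Suc i) * l (Suc i) * bdry n s F (A - Suc i))"
    proof (cases "i = d")
      case True
      then show ?thesis using bot by auto
    next
      case False
      then have i: "i < d" using True by simp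
      then show ?thesis using l[OF i] nz[OF i] ph[OF i] d by (simp add: ee)
    qed
    have "block n d (\<lambda>i. A - i) l (actM k 1 F) (s, i)
      = (-1) ^ (A - i) * (of_nat (n - (A - i)) + 1 / 2 + of_real (k 2) + of_real (k 3)) * (l i * bdry n s F (A - i))
      + l i * (dcoef k 1 (A - i + 1) * bdry n s F (A - i + 1))"
      using True by (simp only: block_def actM_1_bdry[OF F n A] prod.case if_True) (simp add: algebra_simps)
    then have "block n d (\<lambda>i. A - i) l (actM k 1 F) (s, i) = \<epsilon> * OX d a ?v i"
      unfolding OX_block[OF True] up th[OF True] by (simp only: distrib_left mult.assoc)
    moreover have "block n d (\<lambda>i. A - i) l (actM k 3 F) (s, i)
      = (-1) ^ (A - i) * (of_nat (A - i) + 1 / 2 + of_real (k 1) + of_real (k 2)) * (l i * bdry n s F (A - i))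
      - l i * (if A - i = 0 then 0 else dcoef k 3 (n - (A - i) + 1) * bdry n s F (A - i - 1))"
      using True by (simp only: block_def actM_3_bdry[OF F n A] prod.case if_True) (simp add: algebra_simps)
    then have "block n d (\<lambda>i. A - i) l (actM k 3 F) (s, i) = - \<epsilon> * OY d a b c ?v i"
      unfolding OY_block[OF True] dn ths[OF True] by (simp only: distrib_left mult.assoc mult_minus_left) simp
    moreover have "block n d (\<lambda>i. A - i) l (actM k 2 F) (s, i) = - OZ d a b c ?v i"
    proof -
      have "block n d (\<lambda>i. A - i) l (actM k 2 F) (s, i)
        = (-1) ^ (A - i) * (l i * (if A - i = 0 then 0 else dcoef k 3 (n - (A - i) + 1) * bdry n s F (A - i - 1))
          - l i * (dcoef k 1 (A - i + 1) * bdry n s F (A - i + 1)))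
          + (1 / 2 + (-1) ^ (A - i) * (of_real (k 1) + of_real (k 3))) * (l i * bdry n s F (A - i))"
        using True by (simp only: block_def actM_2_bdry[OF F n A] prod.case if_True) (simp add: algebra_simps)
      also have "\<dots> = - OZ d a b c ?v i"
        unfolding OZ_Suc_block[OF d(1) True] up dn ze[OF True] unfolding sg[OF True]
        by (simp add: algebra_simps ee)
      finally show ?thesis .
    qed
    moreover have "g = 1 \<or> g = 2 \<or> g = 3" using g by simp
    ultimately show ?thesis unfolding act by (elim disjE) (simp_all add: act[unfolded One_nat_def])
  qed
qed

text \<open>Here Z plays the role of the lower bidiagonal generator: it couples a to a-1, so the
  exponents increase with the index.\<close>

lemma block_ascending:
  assumes n: "even n" and d: "even d" "d \<le> n" and F: "F \<in> Mn k n"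
    and l: "\<And>i. i < d \<Longrightarrow> l (Suc i) = - l i / dcoef k 3 (n - i)"
    and nz: "\<And>i. i < d \<Longrightarrow> dcoef k 3 (n - i) \<noteq> 0"
    and top: "dcoef k 1 (d + 1) * bdry n s F (d + 1) = 0"
    and th: "\<And>i. i \<le> d \<Longrightarrow> (-1) ^ i * (of_nat i + 1 / 2 + of_real (k 1) + of_real (k 2)) = Otheta d a i"
    and ths: "\<And>i. i \<le> d \<Longrightarrow> (-1) ^ i * (of_nat (n - i) + 1 / 2 + of_real (k 2) + of_real (k 3)) = - Otheta d b i"
    and ze: "\<And>i. i \<le> d \<Longrightarrow> 1 / 2 + (-1) ^ i * (of_real (k 1) + of_real (k 3)) = - Ozeta d c i"
    and ph: "\<And>i. i < d \<Longrightarrow> Ophi d a b c (Suc i) = dcoef k 1 (i + 1) * dcoef k 3 (n - i)"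
    and act: "act 1 = (\<lambda>v x. - OY d a b c v x)" "act 2 = (\<lambda>v x. - OZ d a b c v x)" "act 3 = OX d a"
    and g: "g \<in> {1, 2, 3}"
  shows "(\<lambda>i. block n d (\<lambda>i. i) l (actM k g F) (s, i)) = act g (\<lambda>i. block n d (\<lambda>i. i) l F (s, i))"
proof
  fix i
  let ?v = "\<lambda>i. block n d (\<lambda>i. i) l F (s, i)"
  show "block n d (\<lambda>i. i) l (actM k g F) (s, i) = act g ?v i"
  proof (cases "i \<le> d")
    case False
    then have "act g ?v i = 0"
      using g act OX_car[of d a ?v] OY_car[of d a b c ?v] OZ_car[OF block_car[of n d "\<lambda>i. i" l F s], of a b c]
      by (auto simp: Ocar_def)
    then show ?thesis using False by (simp add: block_def)
  next
    case True
    have A: "i \<le> n" using d True by simp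
    have up: "l i * (dcoef k 1 (i + 1) * bdry n s F (i + 1))
      = - (if i = d then 0 else Ophi d a b c (Suc i) * l (Suc i) * bdry n s F (Suc i))"
    proof (cases "i = d")
      case False
      then have i: "i < d" using True by simp
      then show ?thesis using False l[OF i] nz[OF i] ph[OF i] by simp
    qed (use top in simp)
    have dn: "l i * (if i = 0 then 0 else dcoef k 3 (n - i + 1) * bdry n s F (i - 1))
      = - (if i = 0 then 0 else l (i - 1) * bdry n s F (i - 1))"
    proof (cases i)
      case (Suc j)
      then have "n - i + 1 = n - j" using A by simp
      then show ?thesis using Suc True l[of j] nz[of j] by simp
    qed simp
    have "block n d (\<lambda>i. i) l (actM k 3 F) (s, i) = (-1) ^ i * (of_nat i + 1 / 2 + of_real (k 1) + of_real (k 2)) * (l i * bdry n s F i)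
      - l i * (if i = 0 then 0 else dcoef k 3 (n - i + 1) * bdry n s F (i - 1))"
      using True by (simp only: block_def actM_3_bdry[OF F n A] prod.case if_True) (simp add: algebra_simps)
    also have "\<dots> = OX d a ?v i"
      unfolding OX_block[OF True] dn th[OF True] by simp
    finally have 3: "block n d (\<lambda>i. i) l (actM k 3 F) (s, i) = OX d a ?v i" .
    have "block n d (\<lambda>i. i) l (actM k 1 F) (s, i) = (-1) ^ i * (of_nat (n - i) + 1 / 2 + of_real (k 2) + of_real (k 3)) * (l i * bdry n s F i)
      + l i * (dcoef k 1 (i + 1) * bdry n s F (i + 1))"
      using True by (simp only: block_def actM_1_bdry[OF F n A] prod.case if_True) (simp add: algebra_simps)
    also have "\<dots> = - OY d a b c ?v i"
      unfolding OY_block[OF True] up ths[OF True] by simp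
    finally have 1: "block n d (\<lambda>i. i) l (actM k 1 F) (s, i) = - OY d a b c ?v i" .
    have "block n d (\<lambda>i. i) l (actM k 2 F) (s, i)
        = (-1) ^ i * (l i * (if i = 0 then 0 else dcoef k 3 (n - i + 1) * bdry n s F (i - 1))
          - l i * (dcoef k 1 (i + 1) * bdry n s F (i + 1)))
          + (1 / 2 + (-1) ^ i * (of_real (k 1) + of_real (k 3))) * (l i * bdry n s F i)"
      using True by (simp only: block_def actM_2_bdry[OF F n A] prod.case if_True) (simp add: algebra_simps)
    also have "\<dots> = - OZ d a b c ?v i"
      unfolding OZ_Suc_block[OF d(1) True] up dn ze[OF True]
      by (simp add: algebra_simps)
    finally have 2: "block n d (\<lambda>i. i) l (actM k 2 F) (s, i) = - OZ d a b c ?v i" .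
    have "g = 1 \<or> g = 2 \<or> g = 3" using g by simp
    then show ?thesis using 1 2 3 by (elim disjE) (simp_all only: act)
  qed
qed

lemma descending_quot_iso:
  assumes n: "enat n < tpar (k 2)" "even n" and d: "even d" "d \<le> A" "A \<le> n" and \<epsilon>: "\<epsilon> * \<epsilon> = 1"
    and Z: "\<And>i. i \<le> d \<Longrightarrow> A - i \<notin> Z"
    and V: "V = {F \<in> Mn k n. \<forall>s. \<forall>a\<in>Z. bdry n s F a = 0}"
    and N: "N = {F \<in> V. \<forall>s. \<forall>i\<le>d. bdry n s F (A - i) = 0}"
    and nz: "\<And>i. i < d \<Longrightarrow> dcoef k 1 (A - i) \<noteq> 0"
    and top: "\<And>F s. F \<in> V \<Longrightarrow> bdry n s F (A + 1) = 0"
    and bot: "\<And>F s. F \<in> V \<Longrightarrow> A \<noteq> d \<Longrightarrow> dcoef k 3 (n - (A - d) + 1) * bdry n s F (A - d - 1) = 0"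
    and th: "\<And>i. i \<le> d \<Longrightarrow> (-1) ^ (A - i) * (of_nat (n - (A - i)) + 1 / 2 + of_real (k 2) + of_real (k 3)) = \<epsilon> * Otheta d a i"
    and ths: "\<And>i. i \<le> d \<Longrightarrow> (-1) ^ (A - i) * (of_nat (A - i) + 1 / 2 + of_real (k 1) + of_real (k 2)) = - \<epsilon> * Otheta d b i"
    and ze: "\<And>i. i \<le> d \<Longrightarrow> 1 / 2 + (-1) ^ (A - i) * (of_real (k 1) + of_real (k 3)) = - Ozeta d c i"
    and sg: "\<And>i. i \<le> d \<Longrightarrow> (-1) ^ (A - i) = \<epsilon> * (-1) ^ i"
    and ph: "\<And>i. i < d \<Longrightarrow> Ophi d a b c (Suc i) = dcoef k 3 (n - (A - i) + 1) * dcoef k 1 (A - i)"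
    and act: "act 1 = (\<lambda>v x. \<epsilon> * OX d a v x)" "act 2 = (\<lambda>v x. - OZ d a b c v x)" "act 3 = (\<lambda>v x. - \<epsilon> * OY d a b c v x)"
  shows "bi_quot_iso V N (actM k) (dsum_car (Ocar d)) (dsum_act act)"
proof -
  define l where "l = rec_nat 1 (\<lambda>i y. \<epsilon> * y / dcoef k 1 (A - i))"
  have l: "l 0 = 1" "l (Suc i) = \<epsilon> * l i / dcoef k 1 (A - i)" for i by (simp_all add: l_def)
  have "\<epsilon> \<noteq> 0" using \<epsilon> by auto
  then have lnz: "i \<le> d \<Longrightarrow> l i \<noteq> 0" for i by (induction i) (simp_all add: l nz[unfolded One_nat_def])
  have VM: "F \<in> V \<Longrightarrow> F \<in> Mn k n" for F by (simp add: V)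
  show ?thesis
  proof (rule block_quot_iso[where k = k and l = l, OF n(1) _ _ lnz V N])
    show "inj_on (\<lambda>i. A - i) {..d}" using d(2) by (auto simp: inj_on_def)
    show "\<And>i. i \<le> d \<Longrightarrow> A - i \<le> n \<and> A - i \<notin> Z" using Z d(3) by auto
    show "(\<lambda>i. block n d (\<lambda>i. A - i) l (actM k g F) (s, i)) = act g (\<lambda>i. block n d (\<lambda>i. A - i) l F (s, i))"
      if "F \<in> V" "g \<in> {1, 2, 3}" for F s g
      by (rule block_descending[OF n(2) d \<epsilon> VM[OF that(1)] l(2) nz top[OF that(1)] bot[OF that(1)] th ths ze sg ph act that(2)])
  qed
qed

lemma ascending_quot_iso:
  assumes n: "enat n < tpar (k 2)" "even n" and d: "even d" "d \<le> n"
    and Z: "\<And>i. i \<le> d \<Longrightarrow> i \<notin> Z"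
    and V: "V = {F \<in> Mn k n. \<forall>s. \<forall>a\<in>Z. bdry n s F a = 0}"
    and N: "N = {F \<in> V. \<forall>s. \<forall>i\<le>d. bdry n s F i = 0}"
    and nz: "\<And>i. i < d \<Longrightarrow> dcoef k 3 (n - i) \<noteq> 0"
    and top: "dcoef k 1 (d + 1) = 0"
    and th: "\<And>i. i \<le> d \<Longrightarrow> (-1) ^ i * (of_nat i + 1 / 2 + of_real (k 1) + of_real (k 2)) = Otheta d a i"
    and ths: "\<And>i. i \<le> d \<Longrightarrow> (-1) ^ i * (of_nat (n - i) + 1 / 2 + of_real (k 2) + of_real (k 3)) = - Otheta d b i"
    and ze: "\<And>i. i \<le> d \<Longrightarrow> 1 / 2 + (-1) ^ i * (of_real (k 1) + of_real (k 3)) = - Ozeta d c i"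
    and ph: "\<And>i. i < d \<Longrightarrow> Ophi d a b c (Suc i) = dcoef k 1 (i + 1) * dcoef k 3 (n - i)"
    and act: "act 1 = (\<lambda>v x. - OY d a b c v x)" "act 2 = (\<lambda>v x. - OZ d a b c v x)" "act 3 = OX d a"
  shows "bi_quot_iso V N (actM k) (dsum_car (Ocar d)) (dsum_act act)"
proof -
  define l where "l = rec_nat 1 (\<lambda>i y. - y / dcoef k 3 (n - i))"
  have l: "l 0 = 1" "l (Suc i) = - l i / dcoef k 3 (n - i)" for i by (simp_all add: l_def)
  then have lnz: "i \<le> d \<Longrightarrow> l i \<noteq> 0" for i by (induction i) (simp_all add: l nz[unfolded One_nat_def])
  have VM: "F \<in> V \<Longrightarrow> F \<in> Mn k n" for F by (simp add: V)
  have top': "dcoef k 1 (d + 1) * bdry n s F (d + 1) = 0" for s F by (simp only: top mult_zero_left)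
  show ?thesis
  proof (rule block_quot_iso[where k = k and l = l and \<alpha> = "\<lambda>i. i", OF n(1) _ _ lnz V N])
    show "\<And>i. i \<le> d \<Longrightarrow> i \<le> n \<and> i \<notin> Z" using Z d(2) by auto
    show "(\<lambda>i. block n d (\<lambda>i. i) l (actM k g F) (s, i)) = act g (\<lambda>i. block n d (\<lambda>i. i) l F (s, i))"
      if "F \<in> V" "g \<in> {1, 2, 3}" for F s g
      by (rule block_ascending[OF n(2) d VM[OF that(1)] l(2) nz top' th ths ze ph act that(2)])
  qed simp
qed

section \<open>The three blocks of the exponent axis\<close>

lemma minus_one_power_diff: "i \<le> A \<Longrightarrow> (-1 :: complex) ^ (A - i) = (-1) ^ A * (-1) ^ i"
  by (cases "even A"; cases "even i") simp_all

text \<open>The block consists of the exponents n-t_3 < a <= n. Conditions at exponents below t_1 do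
  not touch it, so one argument serves M_n (Z empty) and M_n(x_1) (Z all of them).\<close>

lemma quot_iso_x3:
  assumes n: "enat n < tpar (k 2)" "even n" and t: "tpar (k 1) = enat t1" "tpar (k 3) = enat t3" "t1 + t3 \<le> n"
    and V: "V = {F \<in> Mn k n. \<forall>s. \<forall>a\<in>Z. bdry n s F a = 0}" and Z: "Z \<subseteq> {..<t1}"
  shows "bi_quot_iso V (V \<inter> Mnx k n 3) (actM k) (dsum_car (Ocar (t3 - 1)))
    (dsum_act (twist (1, - 1) perm23 (Oact (t3 - 1) (of_real (k 2))
       (of_real (- (k 1 + k 2 + k 3) - real n - 1)) (of_real (- k 1)))))"
proof -
  have t3: "odd t3" "2 * k 3 = - real t3" and t1: "odd t1" "2 * k 1 = - real t1"
    using tpar_enat[OF t(1)] tpar_enat[OF t(2)] by auto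
  obtain d where d: "t3 = Suc d" "even d" using t3(1) by (cases t3) auto
  have k3: "k 3 = - (real d + 1) / 2" using t3(2) d by simp
  show ?thesis
  proof (rule descending_quot_iso[where k = k and n = n and A = n and \<epsilon> = 1 and Z = Z, OF n])
    show "even (t3 - 1)" "t3 - 1 \<le> n" using d t by auto
    show "\<And>i. i \<le> t3 - 1 \<Longrightarrow> n - i \<notin> Z" using Z t(3) d by fastforce
    show "V \<inter> Mnx k n 3 = {F \<in> V. \<forall>s. \<forall>i\<le>t3 - 1. bdry n s F (n - i) = 0}"
    proof -
      have "(\<forall>a. n - a < t3 \<longrightarrow> bdry n s F a = 0) \<longleftrightarrow> (\<forall>i\<le>t3 - 1. bdry n s F (n - i) = 0)" if "F \<in> Mn k n" for F s
      proof (intro iffI allI impI)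
        fix a assume 0: "\<forall>i\<le>t3 - 1. bdry n s F (n - i) = 0" and a: "n - a < t3"
        show "bdry n s F a = 0"
          using 0[rule_format, of "n - a"] bdry_above[OF that, of a s] a d by (cases "a \<le> n") auto
      qed (use d in auto)
      note eq = this
      show ?thesis
        unfolding Mnx_3_iff[OF n(1) t(2)]
      proof (rule set_eqI)
        fix F
        show "F \<in> V \<inter> {F \<in> Mn k n. \<forall>s a. n - a < t3 \<longrightarrow> bdry n s F a = 0}
          \<longleftrightarrow> F \<in> {F \<in> V. \<forall>s. \<forall>i\<le>t3 - 1. bdry n s F (n - i) = 0}"
          by (cases "F \<in> Mn k n") (simp_all add: V eq)
      qed
    qed
    show "dcoef k 1 (n - i) \<noteq> 0" if "i < t3 - 1" for i
      using that t(3) d t1 by (auto simp: dcoef_eq_0_iff)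
    show "bdry n s F (n + 1) = 0" if "F \<in> V" for s F
      using that bdry_above[of F k n "n + 1" s] V by simp
    \<comment> \<open>The coupling to the next lower exponent is the factor of T_3 on x_3^(t_3),
      which is zero.\<close>
    have "dcoef k 3 (n - (n - (t3 - 1)) + 1) = 0"
      using t(3) t3 d by (simp add: dcoef_eq_0_iff)
    then show "dcoef k 3 (n - (n - (t3 - 1)) + 1) * bdry n s F (n - (t3 - 1) - 1) = 0" for s F by simp
  next
    fix i assume i: "i \<le> t3 - 1"
    then have i': "i \<le> n" using t(3) by simp
    have p: "(-1 :: complex) ^ (n - i) = (-1) ^ i" using minus_one_power_diff[OF i'] n(2) by simp
    show "(- 1) ^ (n - i) * (of_nat (n - (n - i)) + 1 / 2 + of_real (k 2) + of_real (k 3))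
      = 1 * Otheta (t3 - 1) (of_real (k 2)) i"
      using i' by (simp add: p Otheta_def k3 d field_simps)
    show "(- 1) ^ (n - i) * (of_nat (n - i) + 1 / 2 + of_real (k 1) + of_real (k 2))
      = - 1 * Otheta (t3 - 1) (of_real (- (k 1 + k 2 + k 3) - real n - 1)) i"
      using i' by (simp add: p Otheta_def k3 d of_nat_diff field_simps)
    show "1 / 2 + (- 1) ^ (n - i) * (of_real (k 1) + of_real (k 3)) = - Ozeta (t3 - 1) (of_real (- k 1)) i"
      by (simp add: p Ozeta_def k3 d field_simps)
    show "(- 1 :: complex) ^ (n - i) = 1 * (- 1) ^ i" by (simp add: p)
  next
    fix i assume i: "i < t3 - 1"
    then have i': "i \<le> n" using t(3) by simp
    show "Ophi (t3 - 1) (of_real (k 2)) (of_real (- (k 1 + k 2 + k 3) - real n - 1)) (of_real (- k 1)) (Suc i)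
      = dcoef k 3 (n - (n - i) + 1) * dcoef k 1 (n - i)"
      using i' n(2) by (cases "even i") (simp_all add: Ophi_def dcoef_def k3 d of_nat_diff minus_one_power_diff field_simps)
  qed (simp_all add: V fun_eq_iff twist_def perm23_def sgnaut_def Oact_def)
qed

text \<open>The block a < t_1, read upwards. Its coupling to a = t_1 carries the factor of T_1 on
  x_1^(t_1), which is zero, and conditions at x_3-exponents below t_3 do not reach it.\<close>

lemma quot_iso_x1:
  assumes n: "enat n < tpar (k 2)" "even n" and t: "tpar (k 1) = enat t1" "tpar (k 3) = enat t3" "t1 + t3 \<le> n"
    and V: "V = {F \<in> Mn k n. \<forall>s. \<forall>a\<in>Z. bdry n s F a = 0}" and Z: "Z \<subseteq> {a. n - a < t3}"
  shows "bi_quot_iso V (V \<inter> Mnx k n 1) (actM k) (dsum_car (Ocar (t1 - 1)))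
    (dsum_act (twist (1, - 1) perm123 (Oact (t1 - 1) (of_real (k 2))
       (of_real (- (k 1 + k 2 + k 3) - real n - 1)) (of_real (- k 3)))))"
proof -
  have t3: "odd t3" "2 * k 3 = - real t3" and t1: "odd t1" "2 * k 1 = - real t1"
    using tpar_enat[OF t(1)] tpar_enat[OF t(2)] by auto
  obtain d where d: "t1 = Suc d" "even d" using t1(1) by (cases t1) auto
  have k1: "k 1 = - (real d + 1) / 2" using t1(2) d by simp
  show ?thesis
  proof (rule ascending_quot_iso[where k = k and n = n and Z = Z, OF n])
    show "even (t1 - 1)" "t1 - 1 \<le> n" using d t by auto
    show "\<And>i. i \<le> t1 - 1 \<Longrightarrow> i \<notin> Z" using Z t(3) d by fastforce
    have "a < t1 \<longleftrightarrow> a \<le> t1 - 1" for a using d by auto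
    then show "V \<inter> Mnx k n 1 = {F \<in> V. \<forall>s. \<forall>i\<le>t1 - 1. bdry n s F i = 0}"
      unfolding Mnx_1_iff[OF n(1) t(1)] V by auto
    show "dcoef k 3 (n - i) \<noteq> 0" if "i < t1 - 1" for i
      using that t(3) d t3 by (auto simp: dcoef_eq_0_iff)
    show "dcoef k 1 (t1 - 1 + 1) = 0"
      using t1 d by (simp add: dcoef_eq_0_iff)
  next
    fix i assume i: "i \<le> t1 - 1"
    then have i': "i \<le> n" using t(3) by simp
    show "(- 1) ^ i * (of_nat i + 1 / 2 + of_real (k 1) + of_real (k 2)) = Otheta (t1 - 1) (of_real (k 2)) i"
      using i' by (simp add: Otheta_def k1[unfolded One_nat_def] d field_simps)
    show "(- 1) ^ i * (of_nat (n - i) + 1 / 2 + of_real (k 2) + of_real (k 3))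
      = - Otheta (t1 - 1) (of_real (- (k 1 + k 2 + k 3) - real n - 1)) i"
      using i' by (simp add: Otheta_def k1[unfolded One_nat_def] d of_nat_diff field_simps)
    show "1 / 2 + (- 1) ^ i * (of_real (k 1) + of_real (k 3)) = - Ozeta (t1 - 1) (of_real (- k 3)) i"
      by (simp add: Ozeta_def k1[unfolded One_nat_def] d field_simps)
  next
    fix i assume i: "i < t1 - 1"
    then have i': "i \<le> n" using t(3) by simp
    show "Ophi (t1 - 1) (of_real (k 2)) (of_real (- (k 1 + k 2 + k 3) - real n - 1)) (of_real (- k 3)) (Suc i)
      = dcoef k 1 (i + 1) * dcoef k 3 (n - i)"
      using i' n(2) by (cases "even i") (simp_all add: Ophi_def dcoef_def k1[unfolded One_nat_def] d of_nat_diff minus_one_power_diff field_simps)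
  qed (simp_all add: V fun_eq_iff twist_def perm123_def sgnaut_def Oact_def)
qed

text \<open>On the remaining block t_1 <= a <= n-t_3 the kernel is zero, since an element of the
  intersection has no other values on the plane; this also cuts the couplings at both ends. The top
  exponent n-t_3 is odd, whence the sign -1.\<close>

lemma iso_x1_x3:
  assumes n: "enat n < tpar (k 2)" "even n" and t: "tpar (k 1) = enat t1" "tpar (k 3) = enat t3" "t1 + t3 \<le> n"
  defines "N \<equiv> (real n + 1) / 2"
  shows "bi_iso (Mnx k n 1 \<inter> Mnx k n 3) (actM k) (dsum_car (Ocar (n - t1 - t3)))
    (dsum_act (twist (- 1, 1) perm23 (Oact (n - t1 - t3) (of_real (k 1 + k 2 + N))
       (of_real (- k 2 - k 3 - N)) (of_real (- N)))))"
proof -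
  let ?V = "Mnx k n 1 \<inter> Mnx k n 3" and ?Z = "{a. a < t1 \<or> n - a < t3}"
  have t3: "odd t3" "2 * k 3 = - real t3" and t1: "odd t1" "2 * k 1 = - real t1"
    using tpar_enat[OF t(1)] tpar_enat[OF t(2)] by auto
  have V: "?V = {F \<in> Mn k n. \<forall>s. \<forall>a\<in>?Z. bdry n s F a = 0}"
    unfolding Mnx_1_iff[OF n(1) t(1)] Mnx_3_iff[OF n(1) t(2)] by auto
  obtain d where d: "n = t1 + t3 + d" using t(3) le_Suc_ex by blast
  have de: "even d" using n(2) t1(1) t3(1) d by auto
  have dd: "n - t1 - t3 = d" "n - t3 = t1 + d" using d by auto
  have k1: "k 1 = - real t1 / 2" and k3: "k 3 = - real t3 / 2" using t1 t3 by auto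
  have pos: "t1 > 0" "t3 > 0" using t1(1) t3(1) by (auto intro: odd_pos)
  have Vlin: "(\<lambda>x. e * u x + w x) \<in> ?V" if "u \<in> ?V" "w \<in> ?V" for e u w
    using that unfolding V by (auto simp: Mn_linear bdry_linear)
  have zero: "(\<lambda>_. 0) \<in> ?V"
    unfolding V using Dirac_linear[of k "- 1" "\<lambda>_. 0" "\<lambda>_. 0"] by (simp add: Mn_def PolySpace_def bdry_def)
  have "bi_quot_iso ?V {\<lambda>_. 0} (actM k) (dsum_car (Ocar d))
    (dsum_act (twist (- 1, 1) perm23 (Oact d (of_real (k 1 + k 2 + N))
       (of_real (- k 2 - k 3 - N)) (of_real (- N)))))"
  proof (rule descending_quot_iso[where k = k and n = n and A = "t1 + d" and \<epsilon> = "- 1" and Z = ?Z, OF n de _ _ _ _ V])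
    show "{\<lambda>_. 0} = {F \<in> ?V. \<forall>s. \<forall>i\<le>d. bdry n s F (t1 + d - i) = 0}"
    proof (intro equalityI subsetI)
      fix F assume F: "F \<in> {F \<in> ?V. \<forall>s. \<forall>i\<le>d. bdry n s F (t1 + d - i) = 0}"
      have "bdry n s F a = 0" if "a \<le> n" for s a
      proof (cases "a \<in> ?Z")
        case True
        then show ?thesis using F unfolding V by auto
      next
        case False
        then have "t1 + d - a \<le> d" "t1 + d - (t1 + d - a) = a" using d that by auto
        moreover have "\<forall>s. \<forall>i\<le>d. bdry n s F (t1 + d - i) = 0" using F by simp
        ultimately show ?thesis by metis
      qed
      then show "F \<in> {\<lambda>_. 0}"
        using Mn_bdry_eq_0[of n k F] n(1) F unfolding V by auto
    qed (use zero in \<open>auto simp: bdry_def\<close>)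
    show "dcoef k 1 (t1 + d - i) \<noteq> 0" if "i < d" for i
      using that t1 pos by (auto simp: dcoef_eq_0_iff)
    show "bdry n s F (t1 + d + 1) = 0" if "F \<in> ?V" for s F
      using that pos d unfolding V by auto
    show "dcoef k 3 (n - (t1 + d - d) + 1) * bdry n s F (t1 + d - d - 1) = 0" if "F \<in> ?V" for s F
      using that pos unfolding V by auto
  next
    fix i assume i: "i \<le> d"
    then have i': "i \<le> t1 + d" by simp
    have p: "(-1 :: complex) ^ (t1 + d - i) = - ((-1) ^ i)" using minus_one_power_diff[OF i'] t1(1) de by simp
    have ni: "n - (t1 + d - i) = t3 + i" using i d by simp
    show "(- 1) ^ (t1 + d - i) * (of_nat (n - (t1 + d - i)) + 1 / 2 + of_real (k 2) + of_real (k 3))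
      = - 1 * Otheta d (of_real (k 1 + k 2 + N)) i"
      unfolding p ni by (simp add: Otheta_def k3 k1[unfolded One_nat_def] N_def d field_simps)
    show "(- 1) ^ (t1 + d - i) * (of_nat (t1 + d - i) + 1 / 2 + of_real (k 1) + of_real (k 2))
      = - (- 1) * Otheta d (of_real (- k 2 - k 3 - N)) i"
      using i unfolding p by (simp add: Otheta_def k3 k1[unfolded One_nat_def] N_def d of_nat_diff field_simps)
    show "1 / 2 + (- 1) ^ (t1 + d - i) * (of_real (k 1) + of_real (k 3)) = - Ozeta d (of_real (- N)) i"
      unfolding p by (simp add: Ozeta_def k3 k1[unfolded One_nat_def] N_def d field_simps)
    show "(- 1 :: complex) ^ (t1 + d - i) = - 1 * (- 1) ^ i" by (simp add: p)
  next
    fix i assume i: "i < d"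
    then have ni: "n - (t1 + d - i) = t3 + i" using d by simp
    show "Ophi d (of_real (k 1 + k 2 + N)) (of_real (- k 2 - k 3 - N)) (of_real (- N)) (Suc i)
      = dcoef k 3 (n - (t1 + d - i) + 1) * dcoef k 1 (t1 + d - i)"
      using i de t1(1) t3(1) unfolding ni
      by (cases "even i") (simp_all add: Ophi_def dcoef_def k1[unfolded One_nat_def] k3 N_def d of_nat_diff minus_one_power_diff field_simps)
  qed (use d pos in \<open>auto simp: fun_eq_iff twist_def perm23_def sgnaut_def Oact_def\<close>)
  then show ?thesis
    unfolding dd by (rule bi_iso_quot_zero) (rule Vlin)
qed

text \<open>The parameter changes involved permute the four numbers a+b+c, a-b-c, b-a-c, c-a-b, and
  each nonvanishing condition concerns two of them. The bound on b separates the eigenvalues of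
  Y.\<close>

lemma O_twist_properties:
  fixes a b c :: real
  assumes "even d" and b: "2 * b < - real d"
    and s0: "2 * (a + b + c) < 1 - real d \<or> 2 * (a + b + c) > real d - 3"
    and s1: "2 * (a - b - c) < 1 - real d \<or> 2 * (a - b - c) > real d - 3"
    and s2: "2 * (b - a - c) < 1 - real d \<or> 2 * (b - a - c) > real d - 3"
    and s3: "2 * (c - a - b) < 1 - real d \<or> 2 * (c - a - b) > real d - 3"
  shows "\<sigma> \<in> {perm23, perm123} \<Longrightarrow> s \<in> {(1, - 1), (- 1, 1)} \<Longrightarrow>
      bi_irreducible (Ocar d) (twist s \<sigma> (Oact d (of_real a) (of_real b) (of_real c)))"
    and "bi_iso (Ocar d) (twist (1, - 1) perm23 (Oact d (of_real a) (of_real b) (of_real c)))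
      (Ocar d) (Oact d (of_real a) (of_real (- c)) (of_real (- b)))"
    and "bi_iso (Ocar d) (twist (1, - 1) perm123 (Oact d (of_real a) (of_real b) (of_real c)))
      (Ocar d) (Oact d (of_real (- b)) (of_real (- c)) (of_real a))"
    and "bi_iso (Ocar d) (twist (- 1, 1) perm23 (Oact d (of_real a) (of_real b) (of_real c)))
      (Ocar d) (Oact d (of_real (- a)) (of_real (- c)) (of_real b))"
proof -
  have nz: "Ophi_nz d (of_real a) (of_real b) (of_real c)"
    by (rule Ophi_nz_of_real[OF assms(1) s0 s3])
  have 1: "Ophi_nz d (of_real a) (of_real (- c)) (of_real (- b))"
    using s1 s3 by (intro Ophi_nz_of_real[OF assms(1)]) (auto simp: algebra_simps)
  have 2: "Ophi_nz d (of_real b) (of_real (- a)) (of_real (- c))"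
    using s2 s1 by (intro Ophi_nz_of_real[OF assms(1)]) (auto simp: algebra_simps)
  have 3: "Ophi_nz d (of_real (- b)) (of_real (- c)) (of_real a)"
    using s1 s0 by (intro Ophi_nz_of_real[OF assms(1)]) (auto simp: algebra_simps)
  note m = of_real_minus
  show "\<sigma> \<in> {perm23, perm123} \<Longrightarrow> s \<in> {(1, - 1), (- 1, 1)} \<Longrightarrow>
      bi_irreducible (Ocar d) (twist s \<sigma> (Oact d (of_real a) (of_real b) (of_real c)))"
    by (rule bi_irreducible_twist[OF assms(1) nz 2[unfolded m] Otheta_of_real_neq[OF b _ assms(1)]])
  show "bi_iso (Ocar d) (twist (1, - 1) perm23 (Oact d (of_real a) (of_real b) (of_real c)))
      (Ocar d) (Oact d (of_real a) (of_real (- c)) (of_real (- b)))"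
    unfolding m by (rule bi_iso_perm23_Y[OF assms(1) nz 1[unfolded m]])
  show "bi_iso (Ocar d) (twist (1, - 1) perm123 (Oact d (of_real a) (of_real b) (of_real c)))
      (Ocar d) (Oact d (of_real (- b)) (of_real (- c)) (of_real a))"
    unfolding m by (rule bi_iso_perm123[OF assms(1) nz 3[unfolded m]])
  show "bi_iso (Ocar d) (twist (- 1, 1) perm23 (Oact d (of_real a) (of_real b) (of_real c)))
      (Ocar d) (Oact d (of_real (- a)) (of_real (- c)) (of_real b))"
    unfolding m by (rule bi_iso_perm23_X[OF assms(1) nz 1[unfolded m]])
qed

text \<open>After substituting the values of \<open>\<kappa>\<close> and \<open>\<kappa>'\<close>,
  the number \<open>\<kappa>2\<close> cancels from the first and last pair of bounds and has the
  helpful sign in the others. The pair t, t' is kept symmetric to cover W_2 and W_3 alike.\<close>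

lemma quotient_block_bounds:
  fixes \<kappa> \<kappa>2 \<kappa>' :: real
  assumes t: "odd t" "odd t'" "t + t' \<le> n" and \<kappa>: "2 * \<kappa> = - real t" "2 * \<kappa>' = - real t'" and "\<kappa>2 \<ge> 0"
  defines "d \<equiv> t - 1" and "b \<equiv> - (\<kappa>' + \<kappa>2 + \<kappa>) - real n - 1"
  shows "even d" "2 * b < - real d"
    and "2 * (\<kappa>2 + b + - \<kappa>') < 1 - real d \<or> 2 * (\<kappa>2 + b + - \<kappa>') > real d - 3"
    and "2 * (\<kappa>2 - b - - \<kappa>') < 1 - real d \<or> 2 * (\<kappa>2 - b - - \<kappa>') > real d - 3"
    and "2 * (b - \<kappa>2 - - \<kappa>') < 1 - real d \<or> 2 * (b - \<kappa>2 - - \<kappa>') > real d - 3"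
    and "2 * (- \<kappa>' - \<kappa>2 - b) < 1 - real d \<or> 2 * (- \<kappa>' - \<kappa>2 - b) > real d - 3"
proof -
  have d: "real d = real t - 1" using t(1) by (simp add: d_def of_nat_diff odd_pos Suc_leI)
  have n: "real t + real t' \<le> real n" using t(3) by linarith
  have p: "real t \<ge> 1" "real t' \<ge> 1" using t(1,2) by (auto simp: Suc_leI odd_pos)
  show "even d" using t(1) by (simp add: d_def)
  show "2 * b < - real d"
    using \<kappa> n p assms(6) unfolding b_def d by argo
  show "2 * (\<kappa>2 + b + - \<kappa>') < 1 - real d \<or> 2 * (\<kappa>2 + b + - \<kappa>') > real d - 3"
    using \<kappa> n p assms(6) unfolding b_def d by argo
  show "2 * (\<kappa>2 - b - - \<kappa>') < 1 - real d \<or> 2 * (\<kappa>2 - b - - \<kappa>') > real d - 3"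
    using \<kappa> n p assms(6) unfolding b_def d by argo
  show "2 * (b - \<kappa>2 - - \<kappa>') < 1 - real d \<or> 2 * (b - \<kappa>2 - - \<kappa>') > real d - 3"
    using \<kappa> n p assms(6) unfolding b_def d by argo
  show "2 * (- \<kappa>' - \<kappa>2 - b) < 1 - real d \<or> 2 * (- \<kappa>' - \<kappa>2 - b) > real d - 3"
    using \<kappa> n p assms(6) unfolding b_def d by argo
qed

text \<open>The same cancellation: k_2 occurs with opposite signs in a and b, so it survives only in
  a-b-c and b-a-c, and in the bound on b.\<close>

lemma middle_block_bounds:
  fixes k :: "nat \<Rightarrow> real"
  assumes t: "odd t1" "odd t3" "t1 + t3 \<le> n" "even n" and \<kappa>: "2 * k 1 = - real t1" "2 * k 3 = - real t3" and "k 2 \<ge> 0"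
  defines "d \<equiv> n - t1 - t3" and "N \<equiv> (real n + 1) / 2"
  defines "a \<equiv> k 1 + k 2 + N" and "b \<equiv> - k 2 - k 3 - N"
  shows "even d" "2 * b < - real d"
    and "2 * (a + b + - N) < 1 - real d \<or> 2 * (a + b + - N) > real d - 3"
    and "2 * (a - b - - N) < 1 - real d \<or> 2 * (a - b - - N) > real d - 3"
    and "2 * (b - a - - N) < 1 - real d \<or> 2 * (b - a - - N) > real d - 3"
    and "2 * (- N - a - b) < 1 - real d \<or> 2 * (- N - a - b) > real d - 3"
proof -
  have d: "real d = real n - real t1 - real t3" using t(3) by (simp add: d_def of_nat_diff)
  have n: "real t1 + real t3 \<le> real n" using t(3) by linarith
  have p: "real t1 \<ge> 1" "real t3 \<ge> 1" using t(1,2) by (auto simp: Suc_leI odd_pos)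
  show "even d" using t by (simp add: d_def)
  show "2 * b < - real d"
    using \<kappa> n p assms(7) unfolding a_def b_def N_def d by argo
  show "2 * (a + b + - N) < 1 - real d \<or> 2 * (a + b + - N) > real d - 3"
    using \<kappa> n p assms(7) unfolding a_def b_def N_def d by argo
  show "2 * (a - b - - N) < 1 - real d \<or> 2 * (a - b - - N) > real d - 3"
    using \<kappa> n p assms(7) unfolding a_def b_def N_def d by argo
  show "2 * (b - a - - N) < 1 - real d \<or> 2 * (b - a - - N) > real d - 3"
    using \<kappa> n p assms(7) unfolding a_def b_def N_def d by argo
  show "2 * (- N - a - b) < 1 - real d \<or> 2 * (- N - a - b) > real d - 3"
    using \<kappa> n p assms(7) unfolding a_def b_def N_def d by argo
qed

theorem theorem8p12:
  fixes k :: "nat \<Rightarrow> real" and n t1 t3 :: nat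
  assumes "even n"
    and "tpar (k 1) = enat t1" and "tpar (k 3) = enat t3"
    and "t1 + t3 \<le> n" and "enat n < tpar (k 2)"
  defines "K \<equiv> k 1 + k 2 + k 3" and "N \<equiv> (real n + 1) / 2"
  defines "W1act \<equiv> twist (-1, 1) perm23
             (Oact (n - t1 - t3) (of_real (k 1 + k 2 + N)) (of_real (- k 2 - k 3 - N)) (of_real (- N)))"
    and "W2act \<equiv> twist (1, -1) perm23
             (Oact (t3 - 1) (of_real (k 2)) (of_real (- K - real n - 1)) (of_real (- k 1)))"
    and "W3act \<equiv> twist (1, -1) perm123
             (Oact (t1 - 1) (of_real (k 2)) (of_real (- K - real n - 1)) (of_real (- k 3)))"
  shows
    "bi_iso (Mnx k n 1 \<inter> Mnx k n 3) (actM k)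
            (dsum_car (Ocar (n - t1 - t3))) (dsum_act W1act)
   \<and> bi_quot_iso (Mnx k n 1) (Mnx k n 1 \<inter> Mnx k n 3) (actM k)
            (dsum_car (Ocar (t3 - 1))) (dsum_act W2act)
   \<and> bi_quot_iso (Mn k n) (Mnx k n 3) (actM k)
            (dsum_car (Ocar (t3 - 1))) (dsum_act W2act)
   \<and> bi_quot_iso (Mnx k n 3) (Mnx k n 1 \<inter> Mnx k n 3) (actM k)
            (dsum_car (Ocar (t1 - 1))) (dsum_act W3act)
   \<and> bi_quot_iso (Mn k n) (Mnx k n 1) (actM k)
            (dsum_car (Ocar (t1 - 1))) (dsum_act W3act)
   \<and> (k 2 \<ge> 0 \<longrightarrow>
        bi_irreducible (Ocar (n - t1 - t3)) W1act
      \<and> bi_irreducible (Ocar (t3 - 1)) W2act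
      \<and> bi_irreducible (Ocar (t1 - 1)) W3act
      \<and> bi_iso (Ocar (n - t1 - t3)) W1act (Ocar (n - t1 - t3))
            (Oact (n - t1 - t3) (of_real (- k 1 - k 2 - N)) (of_real N) (of_real (- k 2 - k 3 - N)))
      \<and> bi_iso (Ocar (t3 - 1)) W2act (Ocar (t3 - 1))
            (Oact (t3 - 1) (of_real (k 2)) (of_real (k 1)) (of_real (K + real n + 1)))
      \<and> bi_iso (Ocar (t1 - 1)) W3act (Ocar (t1 - 1))
            (Oact (t1 - 1) (of_real (K + real n + 1)) (of_real (k 3)) (of_real (k 2))))"
proof -
  have n: "enat n < tpar (k 2)" "even n" by fact+
  note t = assms(2,3,4)
  have t1: "odd t1" "2 * k 1 = - real t1" and t3: "odd t3" "2 * k 3 = - real t3"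
    using tpar_enat[OF t(1)] tpar_enat[OF t(2)] by auto
  have V1: "Mnx k n 1 = {F \<in> Mn k n. \<forall>s. \<forall>a\<in>{..<t1}. bdry n s F a = 0}"
    unfolding Mnx_1_iff[OF n(1) t(1)] by auto
  have V3: "Mnx k n 3 = {F \<in> Mn k n. \<forall>s. \<forall>a\<in>{a. n - a < t3}. bdry n s F a = 0}"
    unfolding Mnx_3_iff[OF n(1) t(2)] by auto
  \<comment> \<open>All of M_n is the case of an empty set of vanishing conditions.\<close>
  have V: "Mn k n = {F \<in> Mn k n. \<forall>s. \<forall>a\<in>{}. bdry n s F a = 0}" by simp
  have sub: "Mn k n \<inter> Mnx k n i = Mnx k n i" for i by (auto simp: Mnx_def)
  have i: "bi_iso (Mnx k n 1 \<inter> Mnx k n 3) (actM k) (dsum_car (Ocar (n - t1 - t3))) (dsum_act W1act)"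
    unfolding W1act_def N_def by (rule iso_x1_x3[OF n t])
  have ii: "bi_quot_iso (Mnx k n 1) (Mnx k n 1 \<inter> Mnx k n 3) (actM k) (dsum_car (Ocar (t3 - 1))) (dsum_act W2act)"
    "bi_quot_iso (Mn k n) (Mnx k n 3) (actM k) (dsum_car (Ocar (t3 - 1))) (dsum_act W2act)"
    unfolding W2act_def K_def
    using quot_iso_x3[OF n t V1 order_refl] quot_iso_x3[OF n t V] unfolding sub by simp_all
  have iii: "bi_quot_iso (Mnx k n 3) (Mnx k n 1 \<inter> Mnx k n 3) (actM k) (dsum_car (Ocar (t1 - 1))) (dsum_act W3act)"
    "bi_quot_iso (Mn k n) (Mnx k n 1) (actM k) (dsum_car (Ocar (t1 - 1))) (dsum_act W3act)"
    unfolding W3act_def K_def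
    using quot_iso_x1[OF n t V3 order_refl] quot_iso_x1[OF n t V] unfolding sub by (simp_all add: Int_commute)
  have c: "t3 + t1 \<le> n" using t(3) by simp
  \<comment> \<open>For W_3 the indices 1 and 3 trade places in
    \<open>quotient_block_bounds\<close>, which lists the sum in the opposite order.\<close>
  have K': "k 1 + k 2 + k 3 = k 3 + k 2 + k 1" by simp
  have "bi_irreducible (Ocar (n - t1 - t3)) W1act"
    "bi_iso (Ocar (n - t1 - t3)) W1act (Ocar (n - t1 - t3))
      (Oact (n - t1 - t3) (of_real (- k 1 - k 2 - N)) (of_real N) (of_real (- k 2 - k 3 - N)))" if k2: "k 2 \<ge> 0"
    using O_twist_properties(1)[OF middle_block_bounds[where k = k, OF t1(1) t3(1) t(3) n(2) t1(2) t3(2) k2], of perm23 "(- 1, 1)"]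
      O_twist_properties(4)[OF middle_block_bounds[where k = k, OF t1(1) t3(1) t(3) n(2) t1(2) t3(2) k2]]
    unfolding W1act_def N_def by (simp_all add: algebra_simps)
  moreover have "bi_irreducible (Ocar (t3 - 1)) W2act"
    "bi_iso (Ocar (t3 - 1)) W2act (Ocar (t3 - 1))
      (Oact (t3 - 1) (of_real (k 2)) (of_real (k 1)) (of_real (K + real n + 1)))" if k2: "k 2 \<ge> 0"
    using O_twist_properties(1)[OF quotient_block_bounds[OF t3(1) t1(1) c t3(2) t1(2) k2], of perm23 "(1, - 1)"]
      O_twist_properties(2)[OF quotient_block_bounds[OF t3(1) t1(1) c t3(2) t1(2) k2]]
    unfolding W2act_def K_def by (simp_all add: algebra_simps)
  moreover have "bi_irreducible (Ocar (t1 - 1)) W3act"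
    "bi_iso (Ocar (t1 - 1)) W3act (Ocar (t1 - 1))
      (Oact (t1 - 1) (of_real (K + real n + 1)) (of_real (k 3)) (of_real (k 2)))" if k2: "k 2 \<ge> 0"
    using O_twist_properties(1)[OF quotient_block_bounds[OF t1(1) t3(1) t(3) t1(2) t3(2) k2], of perm123 "(1, - 1)"]
      O_twist_properties(3)[OF quotient_block_bounds[OF t1(1) t3(1) t(3) t1(2) t3(2) k2]]
    unfolding W3act_def K_def K' by (simp_all add: algebra_simps)
  ultimately show ?thesis using i ii iii by blast
qed

end
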